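(* Suppose that $G$ is a finitely generated group having a normal subgroup $N$ of finite index that maps onto a non-abelian free group. Let $p$ be an arbitrary prime. Then $G$ possesses $2^{\aleph_0}$ pairwise non-isomorphic quotients $H_j$, $j\in J$, each of which is periodic and residually finite, such that for every $j\in J$ the natural image of $N$ in $H_j$ is a $p$-group.
   Context: A group is periodic if all its elements have finite order. A $p$-group is a group in which every element has order a power of $p$. *)

theory Defs
  imports "HOL-Algebra.Algebra" "HOL-Computational_Algebra.Primes"
begin

definition fin_gen_group :: "('a, 'b) monoid_scheme \<Rightarrow> bool" where
  "fin_gen_group G \<longleftrightarrow> (\<exists>S. finite S \<and> S \<subseteq> carrier G \<and> generate G S = carrier G)"

fun word_eval :: "('a, 'b) monoid_scheme \<Rightarrow> (bool \<times> 'a) list \<Rightarrow> 'a" where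
  "word_eval G [] = \<one>\<^bsub>G\<^esub>"
| "word_eval G ((b, s) # w) =
     (if b then s else inv\<^bsub>G\<^esub> s) \<otimes>\<^bsub>G\<^esub> word_eval G w"

fun reduced_word :: "(bool \<times> 'a) list \<Rightarrow> bool" where
  "reduced_word [] = True"
| "reduced_word [x] = True"
| "reduced_word ((b, s) # (c, t) # w) =
     (\<not> (s = t \<and> b \<noteq> c) \<and> reduced_word ((c, t) # w))"

definition free_basis :: "('a, 'b) monoid_scheme \<Rightarrow> 'a set \<Rightarrow> bool" where
  "free_basis F S \<longleftrightarrow> S \<subseteq> carrier F \<and> generate F S = carrier F \<and>
     (\<forall>w. w \<noteq> [] \<longrightarrow> snd ` set w \<subseteq> S \<longrightarrow> reduced_word w \<longrightarrow> word_eval F w \<noteq> \<one>\<^bsub>F\<^esub>)"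

definition free_group :: "('a, 'b) monoid_scheme \<Rightarrow> bool" where
  "free_group F \<longleftrightarrow> group F \<and> (\<exists>S. free_basis F S)"

definition nonabelian :: "('a, 'b) monoid_scheme \<Rightarrow> bool" where
  "nonabelian F \<longleftrightarrow> (\<exists>x\<in>carrier F. \<exists>y\<in>carrier F. x \<otimes>\<^bsub>F\<^esub> y \<noteq> y \<otimes>\<^bsub>F\<^esub> x)"

text \<open>Periodic: every element has finite order (group.ord is 0 exactly for infinite order).\<close>
definition periodic_group :: "('a, 'b) monoid_scheme \<Rightarrow> bool" where
  "periodic_group H \<longleftrightarrow> (\<forall>x\<in>carrier H. group.ord H x \<noteq> 0)"

definition residually_finite :: "('a, 'b) monoid_scheme \<Rightarrow> bool" where
  "residually_finite H \<longleftrightarrow> (\<forall>x\<in>carrier H. x \<noteq> \<one>\<^bsub>H\<^esub> \<longrightarrow>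
     (\<exists>M. M \<lhd> H \<and> finite (rcosets\<^bsub>H\<^esub> M) \<and> x \<notin> M))"

definition p_subgroup_set :: "nat \<Rightarrow> ('a, 'b) monoid_scheme \<Rightarrow> 'a set \<Rightarrow> bool" where
  "p_subgroup_set p H S \<longleftrightarrow> (\<forall>x\<in>S. \<exists>k::nat. group.ord H x = p ^ k)"

end

theory Submission
  imports Defs "HOL-Library.Countable_Set"
begin

text \<open>
  Let \<open>F\<close> be free of rank at least 2 and let \<open>V\<close> be normal in \<open>F\<close> with \<open>F/V\<close> a finite
  \<open>p\<close>-group of order \<open>m\<close>. Free derivations with values in the integer-valued functions on \<open>F/V\<close>
  have \<open>2 m\<close> free parameters, and those vanishing on \<open>V\<close> at a base point only \<open>m - 1\<close>. If
  \<open>w\<close> has order exactly \<open>n\<close> modulo \<open>V\<close>, then killing \<open>w\<^sup>n\<close> and its conjugates costs only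
  \<open>m / n\<close> linear equations. Hence, as long as the sum of the \<open>1 / n\<close> over all relators stays below
  1, there is an integer-valued homomorphism of \<open>V\<close> that kills the relators but not \<open>V\<close>, and the
  residually-\<open>p\<close> quotient of \<open>F\<close> by the relators still contains an element of infinite order.

  Now run through the elements of \<open>N\<close>, and make all twists \<open>h (t x t\<^sup>-\<^sup>1)\<close> of each of them torsion by
  adding relators of small weight. In between, take \<open>y\<close> in \<open>N\<close> whose image has infinite order, and
  branch: either kill a large \<open>p\<close>-power of \<open>y\<close> too, or keep it alive in a finite quotient that all
  later relators respect. The branches give continuum many kernels; since \<open>G\<close> is finitely generated,
  each isomorphism type of quotients arises from only countably many of them.
\<close>

section \<open>Derivations of free groups\<close>

text \<open>Pigeonhole, as in Siegel's lemma: for a suitable \<open>B\<close> there are more vectors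
  on \<open>Y\<close> with entries in \<open>{0..B}\<close> than possible value vectors, and the
  difference of two vectors with equal values is a solution.\<close>

lemma integer_system_nontrivial_solution:
  fixes L :: "'i \<Rightarrow> ('x \<Rightarrow> int) \<Rightarrow> int"
  assumes fin: "finite Y" "finite I" and card: "card I < card Y"
    and diff: "\<And>i c d. i \<in> I \<Longrightarrow> L i (\<lambda>x. c x - d x) = L i c - L i d"
    and bound: "\<And>i. i \<in> I \<Longrightarrow> \<exists>M\<ge>0. \<forall>B c. (\<forall>x. \<bar>c x\<bar> \<le> B) \<longrightarrow> \<bar>L i c\<bar> \<le> M * B"
  shows "\<exists>c. (\<exists>x\<in>Y. c x \<noteq> 0) \<and> (\<forall>x. x \<notin> Y \<longrightarrow> c x = 0) \<and> (\<forall>i\<in>I. L i c = 0)"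
proof -
  have "\<forall>i\<in>I. \<exists>M. M \<ge> 0 \<and> (\<forall>B c. (\<forall>x. \<bar>c x\<bar> \<le> B) \<longrightarrow> \<bar>L i c\<bar> \<le> M * B)"
    using bound by blast
  from bchoice[OF this] obtain M where
    M: "\<forall>i\<in>I. M i \<ge> 0 \<and> (\<forall>B c. (\<forall>x. \<bar>c x\<bar> \<le> B) \<longrightarrow> \<bar>L i c\<bar> \<le> M i * B)" ..
  define m where "m = nat (\<Sum>i\<in>I. M i)"
  have Mm: "M i \<le> int m" if "i \<in> I" for i
  proof -
    have "M i \<le> (\<Sum>i\<in>I. M i)" using M by (intro member_le_sum[OF that]) (auto simp: fin)
    then show ?thesis by (simp add: m_def)
  qed
  \<comment> \<open>With this \<open>B\<close>, (2mB+1)^|I| is at most (2m+1)^|I| (B+1)^|I| = B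
    (B+1)^|I|, which is less than (B+1)^(|I|+1).\<close>
  define B where "B = (2 * m + 1) ^ card I"
  define E where "E = (\<lambda>f x. if x \<in> Y then int (f x) else 0)"
  let ?Dom = "PiE Y (\<lambda>_. {0..B})"
  let ?Ran = "PiE I (\<lambda>_. {- int (m * B)..int (m * B)})"
  let ?V = "\<lambda>f. restrict (\<lambda>i. L i (E f)) I"
  have "?V ` ?Dom \<subseteq> ?Ran"
  proof safe
    fix f i assume f: "f \<in> ?Dom" and i: "i \<in> I"
    have "\<forall>x. \<bar>E f x\<bar> \<le> int B" using f by (auto simp: E_def PiE_iff)
    with M i have "\<bar>L i (E f)\<bar> \<le> M i * int B" by simp
    also have "\<dots> \<le> int m * int B" using Mm[OF i] by (intro mult_right_mono) auto
    finally have "\<bar>L i (E f)\<bar> \<le> int (m * B)" by simp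
    then show "restrict (\<lambda>i. L i (E f)) I i \<in> {- int (m * B)..int (m * B)}" using i by auto
  qed auto
  moreover have "card ?Ran < card ?Dom"
  proof -
    have "card {- int (m * B)..int (m * B)} = 2 * m * B + 1" by (simp add: nat_add_distrib nat_mult_distrib)
    then have "card ?Ran = (2 * m * B + 1) ^ card I" by (simp add: card_PiE fin)
    also have "\<dots> \<le> ((2 * m + 1) * (B + 1)) ^ card I"
      by (rule power_mono) (simp_all add: distrib_right)
    also have "\<dots> = (2 * m + 1) ^ card I * (B + 1) ^ card I" by (rule power_mult_distrib)
    also have "\<dots> = B * (B + 1) ^ card I" by (simp only: B_def)
    also have "\<dots> < (B + 1) * (B + 1) ^ card I" by simp
    also have "\<dots> = (B + 1) ^ Suc (card I)" by simp
    also have "\<dots> \<le> (B + 1) ^ card Y" using card by (intro power_increasing) auto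
    also have "\<dots> = card ?Dom" by (simp add: card_PiE fin)
    finally show ?thesis .
  qed
  moreover have "finite ?Ran" using fin by (intro finite_PiE) auto
  ultimately have "\<not> inj_on ?V ?Dom" by (meson card_inj_on_le not_less)
  then obtain f g where fg: "f \<in> ?Dom" "g \<in> ?Dom" "?V f = ?V g" "f \<noteq> g" by (auto simp: inj_on_def)
  define c where "c = (\<lambda>x. E f x - E g x)"
  have "\<exists>x\<in>Y. f x \<noteq> g x" using fg by (metis PiE_ext)
  then have "\<exists>x\<in>Y. c x \<noteq> 0" by (auto simp: c_def E_def)
  moreover have "\<forall>x. x \<notin> Y \<longrightarrow> c x = 0" by (simp add: c_def E_def)
  moreover have "L i c = 0" if i: "i \<in> I" for i
    using fun_cong[OF fg(3), of i] i diff[OF i, of "E f" "E g"] by (simp add: c_def)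
  ultimately show ?thesis by blast
qed

section \<open>Words over a group and their values\<close>

definition inv_word :: "(bool \<times> 'a) list \<Rightarrow> (bool \<times> 'a) list" where
  "inv_word w = rev (map (\<lambda>(b, s). (\<not> b, s)) w)"

lemma snd_set_inv_word [simp]: "snd ` set (inv_word w) = snd ` set w"
  by (force simp: inv_word_def)

lemma not_reduced_word:
  "\<not> reduced_word w \<Longrightarrow> \<exists>u b s v. w = u @ (b, s) # (\<not> b, s) # v"
proof (induction w rule: reduced_word.induct)
  case (3 b s c t w)
  show ?case
  proof (cases "s = t \<and> b \<noteq> c")
    case True
    then show ?thesis by (intro exI[of _ "[]"]) auto
  next
    case False
    then obtain u b' s' v where "(c, t) # w = u @ (b', s') # (\<not> b', s') # v" using 3 by auto
    then have "(b, s) # (c, t) # w = ((b, s) # u) @ (b', s') # (\<not> b', s') # v" by simp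
    then show ?thesis by blast
  qed
qed auto

context group begin

lemma mult_inv_cancel_left:
  assumes "x \<in> carrier G" "y \<in> carrier G"
  shows "x \<otimes> (inv x \<otimes> y) = y" "inv x \<otimes> (x \<otimes> y) = y"
  using assms by (simp_all flip: m_assoc)

lemma word_eval_closed [intro, simp]:
  "snd ` set w \<subseteq> carrier G \<Longrightarrow> word_eval G w \<in> carrier G"
  by (induction w) auto

lemma word_eval_append:
  "snd ` set u \<subseteq> carrier G \<Longrightarrow> snd ` set v \<subseteq> carrier G \<Longrightarrow>
    word_eval G (u @ v) = word_eval G u \<otimes> word_eval G v"
  by (induction u) (auto simp: m_assoc)

lemma word_eval_inv_word:
  "snd ` set w \<subseteq> carrier G \<Longrightarrow> word_eval G (inv_word w) = inv (word_eval G w)"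
  by (induction w)
    (auto simp: inv_word_def word_eval_append inv_mult_group image_image case_prod_beta)

lemma generate_word_eval:
  assumes "S \<subseteq> carrier G" "x \<in> generate G S"
  shows "\<exists>w. snd ` set w \<subseteq> S \<and> word_eval G w = x"
  using assms(2)
proof induction
  case one
  show ?case by (intro exI[of _ "[]"]) auto
next
  case (incl s)
  then show ?case using assms(1) by (intro exI[of _ "[(True, s)]"]) auto
next
  case (inv s)
  then show ?case using assms(1) by (intro exI[of _ "[(False, s)]"]) auto
next
  case (eng x y)
  then obtain u v where "snd ` set u \<subseteq> S" "word_eval G u = x" "snd ` set v \<subseteq> S" "word_eval G v = y"
    by blast
  then show ?case using assms(1) word_eval_append[of u v] by (intro exI[of _ "u @ v"]) auto
qed

end

text \<open>A free derivation with values in the functions on a finite quotient: \<open>fox \<pi> c w q\<close> adds up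
  the weights \<open>c\<close> of the edges traversed in the Cayley graph of \<open>Q\<close> when the word \<open>w\<close> is read
  from right to left starting at the vertex \<open>q\<close>.\<close>

fun fox :: "('c, 'd) monoid_scheme \<Rightarrow> ('q, 'e) monoid_scheme \<Rightarrow> ('c \<Rightarrow> 'q) \<Rightarrow> ('c \<times> 'q \<Rightarrow> int) \<Rightarrow>
    (bool \<times> 'c) list \<Rightarrow> 'q \<Rightarrow> int" where
  "fox F Q \<pi> c [] q = 0"
| "fox F Q \<pi> c ((b, s) # w) q = fox F Q \<pi> c w q +
     (let r = \<pi> (word_eval F w) \<otimes>\<^bsub>Q\<^esub> q in if b then c (s, r) else - c (s, inv\<^bsub>Q\<^esub> (\<pi> s) \<otimes>\<^bsub>Q\<^esub> r))"

lemma fox_diff: "fox F Q \<pi> (\<lambda>x. c x - d x) w q = fox F Q \<pi> c w q - fox F Q \<pi> d w q"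
  by (induction w) (auto simp: Let_def)

lemma fox_bound: "(\<forall>x. \<bar>c x\<bar> \<le> B) \<Longrightarrow> \<bar>fox F Q \<pi> c w q\<bar> \<le> int (length w) * B"
proof (induction w)
  case (Cons a w)
  obtain b s where a: "a = (b, s)" by force
  let ?t = "fox F Q \<pi> c (a # w) q - fox F Q \<pi> c w q"
  have "\<bar>?t\<bar> \<le> B" using Cons.prems by (simp add: a Let_def)
  moreover have "\<bar>fox F Q \<pi> c w q\<bar> \<le> int (length w) * B" using Cons by blast
  ultimately have "\<bar>fox F Q \<pi> c (a # w) q\<bar> \<le> int (length w) * B + B" by linarith
  also have "\<dots> = int (length (a # w)) * B" by (simp add: algebra_simps)
  finally show ?case .
qed simp

section \<open>Path weights and derivations over a quotient of a free group\<close>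

locale free_quotient = F: group F + Q: group Q + group_hom F Q \<pi>
  for F :: "('c, 'd) monoid_scheme" and Q :: "('q, 'e) monoid_scheme" and \<pi> +
  fixes S
  assumes basis: "free_basis F S"
begin

lemma S_sub: "S \<subseteq> carrier F" and S_gen: "generate F S = carrier F"
  using basis by (auto simp: free_basis_def)

lemma fox_append:
  assumes "snd ` set u \<subseteq> S" "snd ` set v \<subseteq> S" "q \<in> carrier Q"
  shows "fox F Q \<pi> c (u @ v) q = fox F Q \<pi> c v q + fox F Q \<pi> c u (\<pi> (word_eval F v) \<otimes>\<^bsub>Q\<^esub> q)"
  using assms(1)
proof (induction u)
  case (Cons a u)
  obtain b s where a: "a = (b, s)" by force
  have "snd ` set u \<subseteq> carrier F" "snd ` set v \<subseteq> carrier F" using Cons.prems assms(2) S_sub by auto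
  then have *: "\<pi> (word_eval F (u @ v)) \<otimes>\<^bsub>Q\<^esub> q = \<pi> (word_eval F u) \<otimes>\<^bsub>Q\<^esub> (\<pi> (word_eval F v) \<otimes>\<^bsub>Q\<^esub> q)"
    using assms(3) by (simp add: F.word_eval_append Q.m_assoc)
  show ?case using Cons by (simp add: a * Let_def)
qed simp

lemma fox_cancel:
  assumes "s \<in> S" "q \<in> carrier Q"
  shows "fox F Q \<pi> c [(b, s), (\<not> b, s)] q = 0"
  using assms S_sub by (cases b) (auto simp: Let_def Q.mult_inv_cancel_left)

text \<open>By freeness of \<open>S\<close>, a nonempty word with trivial value is not reduced. A
  pair of adjacent inverse letters runs along one edge back and forth, so removing it changes
  neither the value nor the weight; induct on the length.\<close>

lemma fox_trivial_word:
  "snd ` set w \<subseteq> S \<Longrightarrow> word_eval F w = \<one>\<^bsub>F\<^esub> \<Longrightarrow> q \<in> carrier Q \<Longrightarrow> fox F Q \<pi> c w q = 0"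
proof (induction "length w" arbitrary: w rule: less_induct)
  case less
  show ?case
  proof (cases "w = []")
    case False
    then have "\<not> reduced_word w" using less.prems basis by (auto simp: free_basis_def)
    then obtain u b s v where w: "w = u @ (b, s) # (\<not> b, s) # v" using not_reduced_word by blast
    have sub: "s \<in> S" "snd ` set u \<subseteq> S" "snd ` set v \<subseteq> S" using less.prems w by auto
    then have sub': "s \<in> carrier F" "snd ` set u \<subseteq> carrier F" "snd ` set v \<subseteq> carrier F" using S_sub by auto
    have c1: "word_eval F [(b, s), (\<not> b, s)] = \<one>\<^bsub>F\<^esub>" using sub' by (cases b) auto
    have ww: "w = u @ [(b, s), (\<not> b, s)] @ v" by (simp add: w)
    have c2: "word_eval F ([(b, s), (\<not> b, s)] @ v) = word_eval F v"
      by (subst F.word_eval_append) (use sub' in \<open>auto simp: c1 simp del: word_eval.simps\<close>)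
    have "word_eval F (u @ v) = word_eval F w"
      unfolding ww by (subst (1 2) F.word_eval_append) (use sub' c2 in auto)
    then have IH: "fox F Q \<pi> c (u @ v) q = 0"
      using less.hyps[of "u @ v"] less.prems sub by (simp add: w)
    have cl: "\<pi> (word_eval F v) \<otimes>\<^bsub>Q\<^esub> q \<in> carrier Q" using sub' less.prems by simp
    have "fox F Q \<pi> c ([(b, s), (\<not> b, s)] @ v) q = fox F Q \<pi> c v q"
      by (subst fox_append) (use sub less.prems cl fox_cancel in \<open>auto simp del: fox.simps\<close>)
    then have "fox F Q \<pi> c w q = fox F Q \<pi> c (u @ v) q"
      unfolding ww by (subst (1 2) fox_append) (use sub less.prems c2 in \<open>auto simp del: fox.simps\<close>)
    then show ?thesis using IH by simp
  qed simp
qed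

text \<open>Both \<open>u @ inv_word v\<close> and \<open>v @ inv_word v\<close> have trivial value,
  hence weight 0, and the part \<open>inv_word v\<close> contributes the same to each.\<close>

lemma fox_cong_word:
  assumes "snd ` set u \<subseteq> S" "snd ` set v \<subseteq> S" "word_eval F u = word_eval F v" "q \<in> carrier Q"
  shows "fox F Q \<pi> c u q = fox F Q \<pi> c v q"
proof -
  have sub: "snd ` set u \<subseteq> carrier F" "snd ` set v \<subseteq> carrier F" using assms S_sub by auto
  let ?x = "word_eval F v" and ?i = "inv_word v"
  \<comment> \<open>Words are read from the right: from \<open>q'\<close> the path of
    \<open>inv_word v\<close> arrives at \<open>q\<close>, where \<open>u\<close> and
    \<open>v\<close> then begin.\<close>
  define q' where "q' = \<pi> ?x \<otimes>\<^bsub>Q\<^esub> q"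
  have q': "q' \<in> carrier Q" "\<pi> (word_eval F ?i) \<otimes>\<^bsub>Q\<^esub> q' = q"
    using assms sub by (auto simp: q'_def F.word_eval_inv_word Q.mult_inv_cancel_left)
  have "fox F Q \<pi> c (w @ ?i) q' = 0"
    if "snd ` set w \<subseteq> S" "snd ` set w \<subseteq> carrier F" "word_eval F w = ?x" for w
    by (rule fox_trivial_word)
      (use that assms(2) sub q' in \<open>simp_all add: image_Un F.word_eval_append F.word_eval_inv_word\<close>)
  from this[of u] this[of v] have "fox F Q \<pi> c (u @ ?i) q' = 0" "fox F Q \<pi> c (v @ ?i) q' = 0"
    using assms sub by simp_all
  then show ?thesis using fox_append[of u ?i q'] fox_append[of v ?i q'] assms q' by simp
qed

definition word_of :: "'c \<Rightarrow> (bool \<times> 'c) list" where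
  "word_of x = (SOME w. snd ` set w \<subseteq> S \<and> word_eval F w = x)"

lemma word_of:
  assumes "x \<in> carrier F"
  shows "snd ` set (word_of x) \<subseteq> S \<and> word_eval F (word_of x) = x"
  unfolding word_of_def by (rule someI_ex) (rule F.generate_word_eval[OF S_sub], simp add: S_gen assms)

text \<open>The choice made by \<open>word_of\<close> is harmless by \<open>fox_cong_word\<close>;
  this is where freeness turns edge weights into a function on \<open>F\<close>.\<close>

definition deriv :: "('c \<times> 'q \<Rightarrow> int) \<Rightarrow> 'c \<Rightarrow> 'q \<Rightarrow> int" where
  "deriv c x q = fox F Q \<pi> c (word_of x) q"

text \<open>The product rule of a derivation into the integer functions on \<open>Q\<close>, on
  which \<open>F\<close> acts by translation through \<open>\<pi>\<close>. The path of
  \<open>y\<close> comes first, so that of \<open>x\<close> starts at a shifted vertex.\<close>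

lemma deriv_mult:
  assumes "x \<in> carrier F" "y \<in> carrier F" "q \<in> carrier Q"
  shows "deriv c (x \<otimes>\<^bsub>F\<^esub> y) q = deriv c y q + deriv c x (\<pi> y \<otimes>\<^bsub>Q\<^esub> q)"
proof -
  note wx = word_of[OF assms(1)] and wy = word_of[OF assms(2)] and wxy = word_of[of "x \<otimes>\<^bsub>F\<^esub> y"]
  have sub: "snd ` set (word_of x) \<subseteq> carrier F" "snd ` set (word_of y) \<subseteq> carrier F"
    using wx wy S_sub by blast+
  have "deriv c (x \<otimes>\<^bsub>F\<^esub> y) q = fox F Q \<pi> c (word_of x @ word_of y) q"
    unfolding deriv_def using wx wy wxy assms sub
    by (intro fox_cong_word) (auto simp: F.word_eval_append)
  then show ?thesis using wx wy assms fox_append[of "word_of x" "word_of y" q c]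
    by (simp add: deriv_def)
qed

text \<open>The values on the basis can be prescribed at will: each basis element contributes one
  free parameter per vertex.\<close>

lemma deriv_basis:
  assumes "s \<in> S" "q \<in> carrier Q"
  shows "deriv c s q = c (s, q)"
proof -
  have "deriv c s q = fox F Q \<pi> c [(True, s)] q" unfolding deriv_def
    using assms S_sub word_of[of s] by (intro fox_cong_word) auto
  then show ?thesis using assms by simp
qed

lemma deriv_one: "q \<in> carrier Q \<Longrightarrow> deriv c \<one>\<^bsub>F\<^esub> q = 0"
  using deriv_mult[of "\<one>\<^bsub>F\<^esub>" "\<one>\<^bsub>F\<^esub>" q c] by simp

lemma deriv_inv:
  assumes "x \<in> carrier F" "q \<in> carrier Q"
  shows "deriv c (inv\<^bsub>F\<^esub> x) q = - deriv c x (inv\<^bsub>Q\<^esub> (\<pi> x) \<otimes>\<^bsub>Q\<^esub> q)"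
  using deriv_mult[of x "inv\<^bsub>F\<^esub> x" q c] assms deriv_one[of q c] by simp

text \<open>On the kernel of \<open>\<pi>\<close> the shift in the product rule disappears, so at
  each vertex \<open>deriv\<close> restricts to a homomorphism into the integers.\<close>

lemma deriv_pow_kernel:
  assumes "x \<in> carrier F" "\<pi> x = \<one>\<^bsub>Q\<^esub>" "q \<in> carrier Q"
  shows "deriv c (x [^]\<^bsub>F\<^esub> (n::nat)) q = int n * deriv c x q"
  using assms by (induction n) (auto simp: deriv_one deriv_mult algebra_simps)

text \<open>Reading \<open>x\<^sup>n\<close> gives a closed path at \<open>q\<close>, and its weight does not depend on where on
  the \<open>x\<close>-orbit it starts; hence a relator \<open>x\<^sup>n\<close> costs only one equation per orbit.\<close>

lemma deriv_pow_orbit: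
  assumes "x \<in> carrier F" "\<pi> (x [^]\<^bsub>F\<^esub> (n::nat)) = \<one>\<^bsub>Q\<^esub>" "q \<in> carrier Q" "r \<in> generate Q {\<pi> x}"
  shows "deriv c (x [^]\<^bsub>F\<^esub> n) (r \<otimes>\<^bsub>Q\<^esub> q) = deriv c (x [^]\<^bsub>F\<^esub> n) q"
proof -
  have step: "deriv c (x [^]\<^bsub>F\<^esub> n) (\<pi> x \<otimes>\<^bsub>Q\<^esub> q) = deriv c (x [^]\<^bsub>F\<^esub> n) q" if "q \<in> carrier Q" for q
  proof -
    have "x [^]\<^bsub>F\<^esub> n \<otimes>\<^bsub>F\<^esub> x = x \<otimes>\<^bsub>F\<^esub> x [^]\<^bsub>F\<^esub> n" using F.nat_pow_Suc2[of x n] assms by simp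
    then show ?thesis using deriv_mult[of x "x [^]\<^bsub>F\<^esub> n" q c] deriv_mult[of "x [^]\<^bsub>F\<^esub> n" x q c] assms that by simp
  qed
  have "r \<in> carrier Q \<and> (\<forall>q\<in>carrier Q. deriv c (x [^]\<^bsub>F\<^esub> n) (r \<otimes>\<^bsub>Q\<^esub> q) = deriv c (x [^]\<^bsub>F\<^esub> n) q)"
    using assms(4)
  proof induction
    case (inv h)
    have "deriv c (x [^]\<^bsub>F\<^esub> n) (inv\<^bsub>Q\<^esub> (\<pi> x) \<otimes>\<^bsub>Q\<^esub> q) = deriv c (x [^]\<^bsub>F\<^esub> n) q" if "q \<in> carrier Q" for q
      using step[of "inv\<^bsub>Q\<^esub> (\<pi> x) \<otimes>\<^bsub>Q\<^esub> q"] that assms by (simp add: Q.mult_inv_cancel_left)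
    then show ?case using inv assms by simp
  qed (use assms step in \<open>auto simp: Q.m_assoc\<close>)
  then show ?thesis using assms by blast
qed

text \<open>Count parameters: \<open>a\<close> and \<open>b\<close> give 2|Q| unknowns. A relator
  from \<open>(w, n)\<close> costs one equation for each of the |Q|/n cosets of the subgroup
  generated by \<open>\<pi> w\<close>, in total fewer than |Q|. Another |Q| equations make chosen
  preimages of the vertices have derivative 0 at the identity, so that a nonzero weight must show up
  on the kernel of \<open>\<pi>\<close>.\<close>

lemma nontrivial_derivation:
  assumes fin: "finite (carrier Q)" and surj: "\<pi> ` carrier F = carrier Q"
    and ab: "a \<in> S" "b \<in> S" "a \<noteq> b"
    and W: "finite W" "\<And>w n. (w, n) \<in> W \<Longrightarrow> w \<in> carrier F \<and> \<pi> (w [^]\<^bsub>F\<^esub> n) = \<one>\<^bsub>Q\<^esub> \<and> Q.ord (\<pi> w) = n"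
    and weight: "(\<Sum>(w, n)\<in>W. 1 / real n) < 1"
  obtains c y q where "\<And>w n r. (w, n) \<in> W \<Longrightarrow> r \<in> carrier Q \<Longrightarrow> deriv c (w [^]\<^bsub>F\<^esub> n) r = 0"
    "y \<in> carrier F" "\<pi> y = \<one>\<^bsub>Q\<^esub>" "q \<in> carrier Q" "deriv c y q \<noteq> 0"
proof -
  define m where "m = card (carrier Q)"
  have m: "m > 0" unfolding m_def using fin by (auto simp: card_gt_0_iff)
  define u where "u = (\<lambda>q. SOME x. x \<in> carrier F \<and> \<pi> x = q)"
  have u: "u q \<in> carrier F \<and> \<pi> (u q) = q" if "q \<in> carrier Q" for q
  proof -
    have "\<exists>x. x \<in> carrier F \<and> \<pi> x = q" using that surj by (metis imageE)
    then show ?thesis unfolding u_def by (rule someI_ex)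
  qed
  define Y where "Y = {a, b} \<times> carrier Q"
  define cosets where "cosets = (\<lambda>w. rcosets\<^bsub>Q\<^esub> (generate Q {\<pi> w}))"
  define I where "I = (SIGMA wn:W. cosets (fst wn)) <+> carrier Q"
  \<comment> \<open>By \<open>deriv_pow_orbit\<close> one vertex from each coset suffices to control
    a relator at all vertices.\<close>
  define L where "L = (\<lambda>i c. case i of Inl ((w, n), C) \<Rightarrow> deriv c (w [^]\<^bsub>F\<^esub> (n::nat)) (SOME q. q \<in> C)
       | Inr q \<Rightarrow> deriv c (u q) \<one>\<^bsub>Q\<^esub>)"
  have gen: "generate Q {\<pi> w} \<subseteq> carrier Q" "subgroup (generate Q {\<pi> w}) Q" if "(w, n) \<in> W" for w n
    using W(2)[OF that] by (auto intro!: Q.generate_incl Q.generate_is_subgroup)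
  have cosets: "finite (cosets w)" "real (card (cosets w)) = real m * (1 / real n)" if wn: "(w, n) \<in> W" for w n
  proof -
    have "cosets w \<subseteq> Pow (carrier Q)" unfolding cosets_def RCOSETS_def
      using gen[OF wn] Q.r_coset_subset_G by blast
    then show "finite (cosets w)" using fin finite_subset by blast
    have "card (generate Q {\<pi> w}) = n" using Q.generate_pow_card[of "\<pi> w"] W(2)[OF wn] by simp
    then have "card (cosets w) * n = m"
      using Q.lagrange[OF gen(2)[OF wn]] by (simp add: cosets_def m_def order_def)
    then show "real (card (cosets w)) = real m * (1 / real n)"
      using m by (auto simp: field_simps simp flip: of_nat_mult)
  qed
  have finY: "finite Y" and cardY: "card Y = 2 * m" using fin ab by (auto simp: Y_def m_def)
  have finS: "finite (SIGMA wn:W. cosets (fst wn))" using cosets(1) W(1) by (intro finite_SigmaI) auto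
  then have finI: "finite I" using fin by (simp add: I_def)
  have "real (card (SIGMA wn:W. cosets (fst wn))) = (\<Sum>wn\<in>W. real (card (cosets (fst wn))))"
    using W(1) cosets(1) by (subst card_SigmaI) auto
  also have "\<dots> = (\<Sum>wn\<in>W. real m * (1 / real (snd wn)))" using cosets(2) by (intro sum.cong) auto
  also have "\<dots> = real m * (\<Sum>(w, n)\<in>W. 1 / real n)" by (simp only: sum_distrib_left case_prod_unfold)
  also have "\<dots> < real m * 1" using weight m by (intro mult_strict_left_mono) auto
  finally have "card I < card Y" using finS fin by (simp add: I_def card_Plus cardY m_def)
  then obtain c where c: "\<exists>x\<in>Y. c x \<noteq> 0" "\<forall>x. x \<notin> Y \<longrightarrow> c x = 0" "\<forall>i\<in>I. L i c = 0"
  proof (rule exE[OF integer_system_nontrivial_solution[OF finY finI, of L]])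
    fix i c d assume "i \<in> I"
    show "L i (\<lambda>x. c x - d x) = L i c - L i d"
      by (auto simp: L_def deriv_def fox_diff split: sum.split)
  next
    fix i assume "i \<in> I"
    \<comment> \<open>Each equation is the weight along a fixed word from a fixed vertex, so the
      length of the word bounds it.\<close>
    have "\<exists>w q. \<forall>c. L i c = fox F Q \<pi> c w q"
      by (cases i) (auto simp: L_def deriv_def split: prod.split)
    then obtain w q where "\<forall>c. L i c = fox F Q \<pi> c w q" by blast
    then show "\<exists>M\<ge>0. \<forall>B c. (\<forall>x. \<bar>c x\<bar> \<le> B) \<longrightarrow> \<bar>L i c\<bar> \<le> M * B"
      using fox_bound by (intro exI[of _ "int (length w)"]) auto
  qed auto
  have "deriv c (w [^]\<^bsub>F\<^esub> n) r = 0" if wn: "(w, n) \<in> W" and r: "r \<in> carrier Q" for w n r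
  proof -
    define C where "C = generate Q {\<pi> w} #>\<^bsub>Q\<^esub> r"
    define q where "q = (SOME q. q \<in> C)"
    have CC: "C \<in> cosets w" unfolding C_def cosets_def RCOSETS_def using r by auto
    have "r \<in> C" unfolding C_def using Q.rcos_self[OF r gen(2)[OF wn]] .
    then have "q \<in> C" unfolding q_def by (rule someI)
    then obtain g where g: "g \<in> generate Q {\<pi> w}" "q = g \<otimes>\<^bsub>Q\<^esub> r" by (auto simp: C_def r_coset_def)
    have "L (Inl ((w, n), C)) c = 0" using c(3) CC wn by (auto simp: I_def)
    then have "deriv c (w [^]\<^bsub>F\<^esub> n) q = 0" by (simp add: L_def q_def)
    then show ?thesis using deriv_pow_orbit[OF _ _ r g(1), of n c] W(2)[OF wn] g(2) by simp
  qed
  moreover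
  have du: "deriv c (u q) \<one>\<^bsub>Q\<^esub> = 0" if "q \<in> carrier Q" for q
  proof -
    have "L (Inr q) c = 0" using c(3) that by (auto simp: I_def)
    then show ?thesis by (simp add: L_def)
  qed
  obtain s q where sq: "s \<in> S" "q \<in> carrier Q" "c (s, q) \<noteq> 0" using c(1) ab by (auto simp: Y_def)
  have s: "s \<in> carrier F" using sq S_sub by auto
  define q' where "q' = \<pi> s \<otimes>\<^bsub>Q\<^esub> q"
  have q': "q' \<in> carrier Q" using s sq by (simp add: q'_def)
  \<comment> \<open>A Schreier generator: the edge \<open>(s, q)\<close> is closed up by the paths
    of \<open>u q\<close> and \<open>u q'\<close> from the identity. These have weight 0, so only
    \<open>c (s, q)\<close> remains.\<close>
  define y where "y = inv\<^bsub>F\<^esub> (u q') \<otimes>\<^bsub>F\<^esub> (s \<otimes>\<^bsub>F\<^esub> u q)"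
  have "y \<in> carrier F" using u q' sq s by (simp add: y_def)
  moreover have "\<pi> y = \<one>\<^bsub>Q\<^esub>" using u[OF q'] u[OF sq(2)] s q' by (simp add: y_def flip: q'_def)
  moreover have "deriv c y \<one>\<^bsub>Q\<^esub> = c (s, q)"
    using u[OF q'] u[OF sq(2)] s q' sq by (simp add: y_def deriv_mult deriv_inv du deriv_basis flip: q'_def)
  ultimately show ?thesis using that[of c y "\<one>\<^bsub>Q\<^esub>"] sq by simp
qed

end

section \<open>Sparse relators\<close>

text \<open>For prime \<open>p\<close> this says that F/V is a finite p-group, phrased inside
  \<open>F\<close>.\<close>

definition p_index_normal :: "nat \<Rightarrow> ('c, 'd) monoid_scheme \<Rightarrow> 'c set \<Rightarrow> bool" where
  "p_index_normal p F V \<longleftrightarrow> V \<lhd> F \<and> finite (rcosets\<^bsub>F\<^esub> V) \<and> (\<forall>x\<in>carrier F. \<exists>k. x [^]\<^bsub>F\<^esub> (p ^ k :: nat) \<in> V)"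

text \<open>The relators \<open>w\<^sup>n\<close> are powers whose exponent \<open>n\<close> is the exact order of the root \<open>w\<close> modulo
  the normal subgroup \<open>V\<close>. This persists when \<open>V\<close> shrinks without losing the relators, so the
  weight bound survives the passage to smaller subgroups.\<close>

definition relators :: "('c, 'd) monoid_scheme \<Rightarrow> ('c \<times> nat) set \<Rightarrow> 'c set" where
  "relators F W = (\<lambda>(w, n). w [^]\<^bsub>F\<^esub> n) ` W"

definition sparse_relators :: "nat \<Rightarrow> ('c, 'd) monoid_scheme \<Rightarrow> ('c \<times> nat) set \<Rightarrow> 'c set \<Rightarrow> bool" where
  "sparse_relators p F W V \<longleftrightarrow> p_index_normal p F V \<and> finite W \<and>
     (\<forall>(w, n)\<in>W. w \<in> carrier F \<and> (\<forall>i::nat. w [^]\<^bsub>F\<^esub> i \<in> V \<longleftrightarrow> n dvd i)) \<and>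
     (\<Sum>(w, n)\<in>W. 1 / real n) < 1"

section \<open>Normal subgroups with finite p-quotient, and the relators they contain\<close>

context group begin

lemma finite_rcosetsI:
  assumes H: "subgroup H G" and fin: "finite (f ` carrier G)"
    and eq: "\<And>x y. x \<in> carrier G \<Longrightarrow> y \<in> carrier G \<Longrightarrow> f x = f y \<Longrightarrow> x \<otimes> inv y \<in> H"
  shows "finite (rcosets H)"
proof -
  define g where "g = (\<lambda>v. H #> (SOME y. y \<in> carrier G \<and> f y = v))"
  have "H #> x = g (f x)" if x: "x \<in> carrier G" for x
  proof -
    define y where "y = (SOME y. y \<in> carrier G \<and> f y = f x)"
    have y: "y \<in> carrier G \<and> f y = f x" unfolding y_def by (rule someI[of _ x]) (simp add: x)
    then have "x \<in> H #> y" using eq[of x y] x subgroup.rcos_module_rev[OF H group_axioms, of y x] by simp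
    then have "H #> y = H #> x" using repr_independence[of x H y] y H by simp
    then show ?thesis by (simp add: g_def y_def)
  qed
  then have "rcosets H \<subseteq> g ` f ` carrier G" by (auto simp: RCOSETS_def)
  then show ?thesis using fin by (meson finite_imageI finite_subset)
qed

lemma rcos_eq_iff:
  assumes "subgroup H G" "x \<in> carrier G" "y \<in> carrier G"
  shows "H #> x = H #> y \<longleftrightarrow> x \<otimes> inv y \<in> H"
proof
  assume "H #> x = H #> y"
  then have "x \<in> H #> y" using rcos_self[OF assms(2,1)] by simp
  then show "x \<otimes> inv y \<in> H" by (rule subgroup.rcos_module_imp[OF assms(1) group_axioms assms(3)])
next
  assume "x \<otimes> inv y \<in> H"
  then have "x \<in> H #> y" using subgroup.rcos_module_rev[OF assms(1) group_axioms] assms by simp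
  then show "H #> x = H #> y" using repr_independence[of x H y] assms by simp
qed

lemma subgroup_pow_dvd:
  assumes "subgroup H G" "x \<in> carrier G" "x [^] (m::nat) \<in> H" "m dvd n"
  shows "x [^] n \<in> H"
proof -
  obtain j where "n = m * j" using assms(4) by blast
  then have "x [^] n = (x [^] m) [^] j" using assms by (simp add: nat_pow_pow)
  moreover have "h [^] (i::nat) \<in> H" if "h \<in> H" for h i
    by (induction i) (use that assms(1) in \<open>auto simp: subgroup.one_closed subgroup.m_closed\<close>)
  ultimately show ?thesis using assms by simp
qed

lemma p_index_normalD:
  assumes "p_index_normal p G V"
  shows "V \<lhd> G" "subgroup V G" "finite (rcosets V)"
    "x \<in> carrier G \<Longrightarrow> \<exists>k. x [^] (p ^ k :: nat) \<in> V"
  using assms by (auto simp: p_index_normal_def normal_imp_subgroup)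

lemma p_index_normal_carrier: "p_index_normal p G (carrier G)"
proof -
  have "carrier G \<lhd> G" by (rule normal_invI) (simp_all add: subgroup_self)
  moreover have "finite (rcosets (carrier G))"
    by (rule finite_rcosetsI[where f = "\<lambda>_. ()"]) (simp_all add: subgroup_self)
  ultimately show ?thesis by (simp add: p_index_normal_def)
qed

lemma p_index_normal_Int:
  assumes U: "p_index_normal p G U" and V: "p_index_normal p G V"
  shows "p_index_normal p G (U \<inter> V)"
  unfolding p_index_normal_def
proof (intro conjI ballI)
  note u = p_index_normalD[OF U] and v = p_index_normalD[OF V]
  show "U \<inter> V \<lhd> G" using u(1) v(1) by (rule normal_subgroup_intersect)
  show "finite (rcosets (U \<inter> V))"
  proof (rule finite_rcosetsI[where f = "\<lambda>x. (U #> x, V #> x)"])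
    show "finite ((\<lambda>x. (U #> x, V #> x)) ` carrier G)"
      by (rule finite_subset[of _ "(rcosets U) \<times> (rcosets V)"]) (use u(3) v(3) in \<open>auto simp: RCOSETS_def\<close>)
  qed (use u(2) v(2) in \<open>simp_all add: rcos_eq_iff subgroups_Inter_pair\<close>)
  fix x assume x: "x \<in> carrier G"
  then obtain k l where "x [^] (p ^ k :: nat) \<in> U" "x [^] (p ^ l :: nat) \<in> V" using u(4) v(4) by blast
  then have "x [^] (p ^ (k + l) :: nat) \<in> U" "x [^] (p ^ (k + l) :: nat) \<in> V"
    using subgroup_pow_dvd[OF u(2) x, of "p ^ k"] subgroup_pow_dvd[OF v(2) x, of "p ^ l"]
    by (simp_all add: power_add)
  then show "\<exists>k. x [^] (p ^ k :: nat) \<in> U \<inter> V" by blast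
qed

lemma sparse_relatorsD:
  assumes "sparse_relators p G W V"
  shows "p_index_normal p G V" "relators G W \<subseteq> V"
  using assms by (auto simp: sparse_relators_def relators_def)

text \<open>A power of \<open>w\<close> in \<open>V'\<close> lies in \<open>V\<close>, so
  \<open>n\<close> divides its exponent; conversely \<open>V'\<close> contains the relator and hence
  its powers.\<close>

lemma sparse_relators_shrink:
  assumes "sparse_relators p G W V" "p_index_normal p G V'" "relators G W \<subseteq> V'" "V' \<subseteq> V"
  shows "sparse_relators p G W V'"
proof -
  have W: "\<forall>(w, n)\<in>W. w \<in> carrier G \<and> (\<forall>i::nat. w [^] i \<in> V \<longleftrightarrow> n dvd i)"
    using assms(1) by (simp add: sparse_relators_def)
  have "w [^] i \<in> V' \<longleftrightarrow> n dvd i" if wn: "(w, n) \<in> W" for w i and n :: nat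
  proof
    show "n dvd i" if "w [^] i \<in> V'" using that assms(4) W wn by blast
    have "w [^] n \<in> V'" using wn assms(3) by (auto simp: relators_def)
    moreover have "w \<in> carrier G" using W wn by blast
    ultimately show "w [^] i \<in> V'" if "n dvd i"
      using that subgroup_pow_dvd[OF p_index_normalD(2)[OF assms(2)]] by blast
  qed
  with W have "\<forall>(w, n)\<in>W. w \<in> carrier G \<and> (\<forall>i::nat. w [^] i \<in> V' \<longleftrightarrow> n dvd i)" by blast
  then show ?thesis using assms(1,2) by (simp add: sparse_relators_def)
qed

text \<open>In other words, \<open>y\<close> has infinite order modulo the intersection of all such
  \<open>V'\<close>. A derivation that vanishes on the relators but not on \<open>y\<close> is
  reduced modulo powers of \<open>p\<close>; each reduction has a kernel \<open>V'\<close> in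
  \<open>V\<close>, and higher powers of \<open>p\<close> detect higher powers of
  \<open>y\<close>.\<close>

lemma exponents_unbounded:
  assumes free: "free_basis G S" and ab: "a \<in> S" "b \<in> S" "a \<noteq> b"
    and p: "Factorial_Ring.prime p" and sparse: "sparse_relators p G W V"
  shows "\<exists>y\<in>carrier G. \<forall>k. \<exists>V'. p_index_normal p G V' \<and> relators G W \<subseteq> V' \<and> y [^] (p ^ k :: nat) \<notin> V'"
proof -
  have W: "finite W" "(\<Sum>(w, n)\<in>W. 1 / real n) < 1"
    "\<And>w n i. (w, n) \<in> W \<Longrightarrow> w \<in> carrier G \<and> (w [^] (i::nat) \<in> V \<longleftrightarrow> n dvd i)"
    using sparse unfolding sparse_relators_def by auto
  note V = p_index_normalD[OF sparse_relatorsD(1)[OF sparse]]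
  interpret V: normal V G by (rule V)
  let ?Q = "G Mod V" and ?\<pi> = "\<lambda>x. V #> x"
  have ker: "V #> x = \<one>\<^bsub>?Q\<^esub> \<longleftrightarrow> x \<in> V" if "x \<in> carrier G" for x
    using rcos_eq_iff[OF V(2) that one_closed] that coset_mult_one[OF V.subset] by simp
  interpret free_quotient G ?Q ?\<pi> S
    using V.factorgroup_is_group V.r_coset_hom_Mod free
    by (intro free_quotient.intro group_hom.intro group_hom_axioms.intro free_quotient_axioms.intro group_axioms)
  note mult_FactGroup [simp del] and one_FactGroup [simp del]
  have carQ: "carrier ?Q = ?\<pi> ` carrier G" by (rule carrier_FactGroup)
  have finQ: "finite (carrier ?Q)" using V(3) by (simp add: FactGroup_def)
  obtain c y q where D: "\<And>w n r. (w, n) \<in> W \<Longrightarrow> r \<in> carrier ?Q \<Longrightarrow> deriv c (w [^] n) r = 0"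
    "y \<in> carrier G" "V #> y = \<one>\<^bsub>?Q\<^esub>" "q \<in> carrier ?Q" "deriv c y q \<noteq> 0"
  proof (rule nontrivial_derivation[OF finQ carQ[symmetric] ab W(1) _ W(2)])
    fix w n assume wn: "(w, n) \<in> W"
    note w = W(3)[OF this]
    have "w [^] n \<in> V" using w by simp
    moreover have "(V #> w) [^]\<^bsub>?Q\<^esub> i = \<one>\<^bsub>?Q\<^esub> \<longleftrightarrow> n dvd i" for i :: nat
      using w[of i] ker[of "w [^] i"] hom_nat_pow[of w i] by simp
    then have "Q.ord (V #> w) = n" using w hom_closed[of w] by (subst Q.ord_unique) auto
    ultimately show "w \<in> carrier G \<and> V #> (w [^] n) = \<one>\<^bsub>?Q\<^esub> \<and> Q.ord (V #> w) = n"
      using w ker by simp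
  qed auto
  let ?D = "deriv c"
  \<comment> \<open>On \<open>V\<close> a conjugation only moves the vertex, so a condition imposed
    at all vertices is invariant.\<close>
  have D_conj: "?D (f \<otimes> v \<otimes> inv f) r = ?D v (inv\<^bsub>?Q\<^esub> (V #> f) \<otimes>\<^bsub>?Q\<^esub> r)"
    if "f \<in> carrier G" "v \<in> V" "r \<in> carrier ?Q" for f v r
  proof -
    have v: "v \<in> carrier G" "V #> v = \<one>\<^bsub>?Q\<^esub>" using that ker V.subset by auto
    show ?thesis using v that deriv_mult[of "f \<otimes> v" "inv f" r c]
        deriv_mult[of f v "inv\<^bsub>?Q\<^esub> (V #> f) \<otimes>\<^bsub>?Q\<^esub> r" c] deriv_inv[of f r c]
      by simp
  qed
  have "\<exists>V'. p_index_normal p G V' \<and> relators G W \<subseteq> V' \<and> y [^] (p ^ k :: nat) \<notin> V'" for k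
  proof -
    \<comment> \<open>With d = \<open>?D y q\<close> nonzero, p^|d| exceeds |d|, so p^j cannot
      divide p^k d, the derivative of the k-th p-power of \<open>y\<close> at
      \<open>q\<close>.\<close>
    define j where "j = k + nat \<bar>?D y q\<bar>"
    define V' where "V' = {x \<in> V. \<forall>r\<in>carrier ?Q. int (p ^ j) dvd ?D x r}"
    have VV: "x \<in> carrier G \<and> V #> x = \<one>\<^bsub>?Q\<^esub>" if "x \<in> V" for x using that ker V.subset by auto
    have sub: "subgroup V' G"
    proof (rule subgroupI)
      show "V' \<subseteq> carrier G" using V.subset by (auto simp: V'_def)
      show "V' \<noteq> {}" using deriv_one by (auto simp: V'_def intro!: exI[of _ \<one>])
      show "inv x \<in> V'" if "x \<in> V'" for x
        using that VV[of x] by (auto simp: V'_def deriv_inv)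
      show "x \<otimes> z \<in> V'" if "x \<in> V'" "z \<in> V'" for x z
        using that VV[of x] VV[of z] by (auto simp: V'_def deriv_mult)
    qed
    have "V' \<lhd> G"
      using sub by (rule normal_invI) (auto simp: V'_def V.inv_op_closed2 D_conj)
    \<comment> \<open>A coset of \<open>V'\<close> is determined by its coset of \<open>V\<close>
      and by the derivatives modulo p^j at the finitely many vertices.\<close>
    moreover have "finite (rcosets V')"
    proof (rule finite_rcosetsI[OF sub, where f = "\<lambda>x. (V #> x, restrict (\<lambda>r. ?D x r mod int (p ^ j)) (carrier ?Q))"])
      have "p > 0" using p by (simp add: prime_gt_0_nat)
      then have "(\<lambda>x. (V #> x, restrict (\<lambda>r. ?D x r mod int (p ^ j)) (carrier ?Q))) ` carrier G
          \<subseteq> carrier ?Q \<times> PiE (carrier ?Q) (\<lambda>_. {0..<int (p ^ j)})"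
        by (intro image_subsetI) simp
      moreover have "finite (carrier ?Q \<times> PiE (carrier ?Q) (\<lambda>_. {0..<int (p ^ j)}))"
        using finQ by (intro finite_cartesian_product finite_PiE) auto
      ultimately show "finite ((\<lambda>x. (V #> x, restrict (\<lambda>r. ?D x r mod int (p ^ j)) (carrier ?Q))) ` carrier G)"
        by (rule finite_subset)
      fix x z assume x: "x \<in> carrier G" and z: "z \<in> carrier G"
        and eq: "(V #> x, restrict (\<lambda>r. ?D x r mod int (p ^ j)) (carrier ?Q)) =
          (V #> z, restrict (\<lambda>r. ?D z r mod int (p ^ j)) (carrier ?Q))"
      have "x \<otimes> inv z \<in> V" using eq rcos_eq_iff[OF V(2) x z] by simp
      moreover have "int (p ^ j) dvd ?D (x \<otimes> inv z) r" if r: "r \<in> carrier ?Q" for r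
      proof -
        \<comment> \<open>In the product rule for \<open>x \<otimes> inv z\<close> the derivatives
          of both \<open>x\<close> and \<open>z\<close> are taken at this one vertex.\<close>
        define r' where "r' = inv\<^bsub>?Q\<^esub> (V #> z) \<otimes>\<^bsub>?Q\<^esub> r"
        have r': "r' \<in> carrier ?Q" using r z by (simp add: r'_def)
        have "restrict (\<lambda>r. ?D x r mod int (p ^ j)) (carrier ?Q) r' =
          restrict (\<lambda>r. ?D z r mod int (p ^ j)) (carrier ?Q) r'" using eq by simp
        then have "?D x r' mod int (p ^ j) = ?D z r' mod int (p ^ j)" using r' by simp
        then have "int (p ^ j) dvd ?D x r' - ?D z r'" by (simp add: mod_eq_dvd_iff)
        moreover have "?D (x \<otimes> inv z) r = ?D x r' - ?D z r'"
          using deriv_mult[of x "inv z" r c] deriv_inv[of z r c] x z r by (simp add: r'_def)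
        ultimately show ?thesis by simp
      qed
      ultimately show "x \<otimes> inv z \<in> V'" by (simp add: V'_def)
    qed
    moreover have "\<exists>l. x [^] (p ^ l :: nat) \<in> V'" if x: "x \<in> carrier G" for x
    proof -
      obtain i where i: "x [^] (p ^ i :: nat) \<in> V" using V(4)[OF x] by blast
      let ?x = "x [^] (p ^ i :: nat)"
      have "?x [^] (p ^ j :: nat) \<in> V" using i x subgroup_pow_dvd[OF V(2), of ?x 1] by simp
      moreover have "?D (?x [^] (p ^ j :: nat)) r = int (p ^ j) * ?D ?x r" if "r \<in> carrier ?Q" for r
        using VV[OF i] that by (intro deriv_pow_kernel) auto
      ultimately have "?x [^] (p ^ j :: nat) \<in> V'" by (simp add: V'_def)
      then have "x [^] (p ^ (i + j) :: nat) \<in> V'" using x by (simp add: nat_pow_pow power_add)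
      then show ?thesis by blast
    qed
    moreover have "relators G W \<subseteq> V'" 
    proof
      fix x assume "x \<in> relators G W"
      then obtain w n where wn: "(w, n) \<in> W" "x = w [^] n" by (auto simp: relators_def)
      then show "x \<in> V'" using W(3)[OF wn(1), of n] D(1)[OF wn(1)] by (simp add: V'_def)
    qed
    moreover have "y [^] (p ^ k :: nat) \<notin> V'"
    proof
      assume "y [^] (p ^ k :: nat) \<in> V'"
      then have "int (p ^ j) dvd ?D (y [^] (p ^ k :: nat)) q" using D(4) by (simp add: V'_def)
      then have "int (p ^ k) * int p ^ nat \<bar>?D y q\<bar> dvd int (p ^ k) * ?D y q"
        by (simp add: deriv_pow_kernel[OF D(2,3,4)] j_def power_add)
      then have "int p ^ nat \<bar>?D y q\<bar> dvd ?D y q"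
        using prime_gt_0_nat[OF p] by (subst (asm) dvd_mult_cancel_left) simp
      from dvd_imp_le_int[OF D(5) this] have "int p ^ nat \<bar>?D y q\<bar> \<le> \<bar>?D y q\<bar>" by simp
      moreover have "int (nat \<bar>?D y q\<bar>) < int (2 ^ nat \<bar>?D y q\<bar>)" by (simp only: of_nat_less_iff less_exp)
      moreover have "int (2 ^ nat \<bar>?D y q\<bar>) \<le> int p ^ nat \<bar>?D y q\<bar>"
        using prime_ge_2_nat[OF p] by (simp add: power_mono)
      ultimately show False by linarith
    qed
    ultimately show ?thesis unfolding p_index_normal_def by blast
  qed
  then show ?thesis using D(2) by blast
qed

text \<open>Either the present relators already force a power of \<open>w\<close> into every such
  \<open>U\<close>, or the order of \<open>w\<close> can be made as large as desired by shrinking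
  \<open>V\<close>. In the second case \<open>w\<close> raised to its new order is a relator of
  small weight.\<close>

lemma kill_power:
  assumes p: "Factorial_Ring.prime p" and sparse: "sparse_relators p G W V" and w: "w \<in> carrier G"
  shows "\<exists>W' V' k. sparse_relators p G W' V' \<and> W \<subseteq> W' \<and> V' \<subseteq> V \<and>
    (\<forall>U. p_index_normal p G U \<longrightarrow> relators G W' \<subseteq> U \<longrightarrow> w [^] (p ^ k :: nat) \<in> U)"
proof (cases "\<exists>k. \<forall>U. p_index_normal p G U \<longrightarrow> relators G W \<subseteq> U \<longrightarrow> w [^] (p ^ k :: nat) \<in> U")
  case True
  then show ?thesis using sparse by blast
next
  case False
  have W: "finite W" "(\<Sum>(w, n)\<in>W. 1 / real n) < 1"
    using sparse unfolding sparse_relators_def by auto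
  \<comment> \<open>A weight of at most 2^-l still fits below 1.\<close>
  obtain l where l: "(1 / 2) ^ l < 1 - (\<Sum>(w, n)\<in>W. 1 / real n)"
    using real_arch_pow_inv[of "1 - (\<Sum>(w, n)\<in>W. 1 / real n)" "1/2"] W(2) by auto
  \<comment> \<open>Intersecting \<open>V\<close> with this \<open>U\<close> makes the order of
    \<open>w\<close> a power p^e with \<open>l < e\<close>.\<close>
  obtain U where U: "p_index_normal p G U" "relators G W \<subseteq> U" "w [^] (p ^ l :: nat) \<notin> U"
    using False by blast
  define V' where "V' = U \<inter> V"
  have V': "p_index_normal p G V'" "relators G W \<subseteq> V'" "V' \<subseteq> V"
    using U sparse_relatorsD[OF sparse] p_index_normal_Int by (auto simp: V'_def)
  have sparse': "sparse_relators p G W V'" by (rule sparse_relators_shrink[OF sparse V'])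
  interpret V': normal V' G using V' by (simp add: p_index_normalD)
  interpret Q: group "G Mod V'" by (rule V'.factorgroup_is_group)
  have Qw: "V' #> w \<in> carrier (G Mod V')" using w by (simp add: carrier_FactGroup)
  define n where "n = Q.ord (V' #> w)"
  have ord: "w [^] i \<in> V' \<longleftrightarrow> n dvd i" for i :: nat
    using Q.pow_eq_id[OF Qw, of i] w rcos_eq_iff[OF V'.subgroup_axioms, of "w [^] i" \<one>]
      coset_mult_one[OF V'.subset]
    by (simp add: n_def V'.FactGroup_pow)
  obtain k where k: "w [^] (p ^ k :: nat) \<in> V'" using p_index_normalD(4)[OF V'(1) w] by blast
  then have "n dvd p ^ k" using ord by blast
  then obtain e where e: "n = p ^ e" using divides_primepow_nat[OF p] by blast
  have "\<not> n dvd p ^ l" using U(3) ord by (auto simp: V'_def)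
  then have "l < e" unfolding e by (meson le_imp_power_dvd not_less)
  have "(2::real) ^ l \<le> 2 ^ e" using \<open>l < e\<close> by (intro power_increasing) auto
  also have "\<dots> \<le> real p ^ e" using prime_ge_2_nat[OF p] by (intro power_mono) auto
  finally have "1 / real n \<le> (1 / 2) ^ l"
    using prime_gt_0_nat[OF p] by (simp add: e field_simps power_one_over)
  \<comment> \<open>If the pair was already present the sum stays unchanged, hence only an
    inequality.\<close>
  moreover have "(\<Sum>(w, n)\<in>insert (w, n) W. 1 / real n) \<le> 1 / real n + (\<Sum>(w, n)\<in>W. 1 / real n)"
    using W(1) by (cases "(w, n) \<in> W") (simp_all add: insert_absorb)
  ultimately have "(\<Sum>(w, n)\<in>insert (w, n) W. 1 / real n) < 1" using l by linarith
  then have "sparse_relators p G (insert (w, n) W) V'"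
    using sparse' w ord unfolding sparse_relators_def by auto
  moreover have "w [^] (p ^ e :: nat) \<in> U" if "relators G (insert (w, n) W) \<subseteq> U" for U
    using that by (simp add: relators_def e)
  ultimately show ?thesis using V'(3) by blast
qed

lemma kill_powers:
  assumes p: "Factorial_Ring.prime p" and "finite A" "A \<subseteq> carrier G" "sparse_relators p G W V"
  shows "\<exists>W' V' k. sparse_relators p G W' V' \<and> W \<subseteq> W' \<and> V' \<subseteq> V \<and>
    (\<forall>U. p_index_normal p G U \<longrightarrow> relators G W' \<subseteq> U \<longrightarrow> (\<forall>w\<in>A. w [^] (p ^ k :: nat) \<in> U))"
  using assms(2-)
proof (induction A)
  case empty
  then show ?case by (intro exI[of _ W] exI[of _ V] exI[of _ 0]) simp
next
  case (insert a A)
  have "A \<subseteq> carrier G" and a: "a \<in> carrier G" using insert.prems(1) by simp_all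
  from insert.IH[OF this(1) insert.prems(2)]
  obtain W1 V1 k where 1: "sparse_relators p G W1 V1" "W \<subseteq> W1" "V1 \<subseteq> V"
    "\<And>U w. p_index_normal p G U \<Longrightarrow> relators G W1 \<subseteq> U \<Longrightarrow> w \<in> A \<Longrightarrow> w [^] (p ^ k :: nat) \<in> U"
    by (elim exE conjE) blast
  from kill_power[OF p 1(1) a] obtain W2 V2 l where 2: "sparse_relators p G W2 V2" "W1 \<subseteq> W2" "V2 \<subseteq> V1"
    "\<And>U. p_index_normal p G U \<Longrightarrow> relators G W2 \<subseteq> U \<Longrightarrow> a [^] (p ^ l :: nat) \<in> U" by blast
  have "w [^] (p ^ (k + l) :: nat) \<in> U"
    if U: "p_index_normal p G U" "relators G W2 \<subseteq> U" and w: "w \<in> insert a A" for U w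
  proof -
    have "relators G W1 \<subseteq> U" using U(2) 2(2) by (auto simp: relators_def)
    then have "w [^] (p ^ k :: nat) \<in> U \<or> w [^] (p ^ l :: nat) \<in> U"
      using 1(4)[OF U(1), of w] 2(4)[OF U] w by (cases "w = a") simp_all
    moreover have "w \<in> carrier G" using w insert.prems(1) by (rule subsetD[rotated])
    ultimately show ?thesis
      using subgroup_pow_dvd[OF p_index_normalD(2)[OF U(1)], of w "p ^ k" "p ^ (k + l)"]
        subgroup_pow_dvd[OF p_index_normalD(2)[OF U(1)], of w "p ^ l" "p ^ (k + l)"]
      by (auto simp: power_add)
  qed
  moreover have "W \<subseteq> W2" "V2 \<subseteq> V" using 1 2 by auto
  ultimately show ?case using 2(1) by (intro exI conjI allI impI ballI)
qed

text \<open>With at most one basis element the group would be cyclic, hence abelian.\<close>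

lemma nonabelian_basis:
  assumes "free_basis G S" "nonabelian G"
  shows "\<exists>a\<in>S. \<exists>b\<in>S. a \<noteq> b"
proof (rule ccontr)
  assume "\<not> ?thesis"
  then obtain a where S: "S \<subseteq> {a}" by (cases "S = {}") blast+
  have SG: "S \<subseteq> carrier G" "generate G S = carrier G" using assms(1) by (auto simp: free_basis_def)
  obtain g where g: "g \<in> carrier G" "S \<subseteq> {g}"
    using S SG by (cases "S = {}") (blast, use one_closed in blast)
  have "carrier G \<subseteq> generate G {g}" using mono_generate[OF g(2)] SG by simp
  then have "\<exists>k. x = g [^] (k::int)" if "x \<in> carrier G" for x using generate_pow[OF g(1)] that by auto
  then have "x \<otimes> y = y \<otimes> x" if "x \<in> carrier G" "y \<in> carrier G" for x y
    using that g(1) by (metis int_pow_mult add.commute)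
  then show False using assms(2) by (auto simp: nonabelian_def)
qed

end

section \<open>Counting quotients up to isomorphism\<close>

text \<open>An infinite family of countable sets covers no more points than the family has members, so
  there are at least continuum many classes.\<close>

lemma continuum_many_classes:
  fixes R :: "(nat set \<times> nat set) set"
  assumes equiv: "equiv UNIV R" and count: "\<And>j. countable (R `` {j})"
  shows "\<exists>\<iota> :: nat set \<Rightarrow> nat set. \<forall>i j. i \<noteq> j \<longrightarrow> (\<iota> i, \<iota> j) \<notin> R"
proof -
  let ?C = "UNIV // R"
  have C: "countable c" if "c \<in> ?C" for c using that count by (auto elim!: quotientE)
  have Un: "(\<Union>c\<in>?C. c) = UNIV" using Union_quotient[OF equiv] by simp
  \<comment> \<open>Finitely many countable classes would make the power set of \<open>nat\<close>
    countable. Infinity of \<open>?C\<close> also lets cardinal arithmetic bound the union of the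
    classes by \<open>?C\<close>.\<close>
  have "infinite ?C"
  proof
    assume "finite ?C"
    then have "countable (\<Union>c\<in>?C. c)" by (intro countable_UN C) (simp add: countable_finite)
    then have "countable (UNIV :: nat set set)" unfolding Un .
    then obtain f :: "nat \<Rightarrow> nat set" where "range f = UNIV" using uncountable_def[of "UNIV :: nat set set"] by auto
    then show False using Cantors_theorem[of "UNIV :: nat set"] by simp
  qed
  have "|c| \<le>o |?C|" if "c \<in> ?C" for c
  proof -
    have "|c| \<le>o |UNIV :: nat set|"
      by (subst card_of_ordLeq[symmetric]) (use C[OF that] in \<open>auto simp: countable_def\<close>)
    then show ?thesis using \<open>infinite ?C\<close> ordLeq_transitive by (auto simp: infinite_iff_card_of_nat)
  qed
  then have "|\<Union>c\<in>?C. c| \<le>o |?C|"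
    by (intro card_of_UNION_ordLeq_infinite[OF \<open>infinite ?C\<close>]) simp_all
  then have "|UNIV :: nat set set| \<le>o |?C|" unfolding Un .
  then obtain f :: "nat set \<Rightarrow> nat set set" where f: "inj f" "range f \<subseteq> ?C"
    by (subst (asm) card_of_ordLeq[symmetric]) blast
  \<comment> \<open>Distinct arguments are sent into distinct classes, because \<open>f\<close> is
    injective.\<close>
  define \<iota> where "\<iota> = (\<lambda>i. SOME j. j \<in> f i)"
  have mem: "\<iota> i \<in> f i" for i
  proof -
    have "f i \<noteq> {}" using f(2) in_quotient_imp_non_empty[OF equiv] by blast
    then show ?thesis unfolding \<iota>_def by (rule some_in_eq[THEN iffD2])
  qed
  have "(\<iota> i, \<iota> j) \<notin> R" if "i \<noteq> j" for i j
  proof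
    assume "(\<iota> i, \<iota> j) \<in> R"
    then have "f i = f j" using quotient_eqI[OF equiv _ _ mem mem] f(2) by blast
    then show False using f(1) that by (simp add: inj_eq)
  qed
  then show ?thesis by blast
qed

section \<open>Countability of the isomorphism classes\<close>

lemma hom_eq_on_generate:
  assumes "group G" "group H" "f \<in> hom G H" "g \<in> hom G H" "S \<subseteq> carrier G"
    and eq: "\<And>s. s \<in> S \<Longrightarrow> f s = g s" and x: "x \<in> generate G S"
  shows "f x = g x"
proof -
  interpret G: group G by fact
  interpret f: group_hom G H f using assms by (simp add: group_hom_def group_hom_axioms_def)
  interpret g: group_hom G H g using assms by (simp add: group_hom_def group_hom_axioms_def)
  show ?thesis using x
  proof induction
    case (eng x y)
    moreover have "x \<in> carrier G" "y \<in> carrier G" using G.generate_incl[OF assms(5)] eng by auto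
    ultimately show ?case by simp
  qed (use eq assms(5) in auto)
qed

lemma fin_gen_group_countable:
  assumes "group G" "fin_gen_group G"
  shows "countable (carrier G)"
proof -
  obtain S where S: "finite S" "S \<subseteq> carrier G" "generate G S = carrier G"
    using assms by (auto simp: fin_gen_group_def)
  have "carrier G \<subseteq> word_eval G ` lists (UNIV \<times> S)"
  proof
    fix x assume "x \<in> carrier G"
    then obtain w where w: "snd ` set w \<subseteq> S" "word_eval G w = x"
      using group.generate_word_eval[OF assms(1) S(2), of x] S(3) by blast
    then have "w \<in> lists (UNIV \<times> S)" by (auto simp: lists_eq_set)
    then show "x \<in> word_eval G ` lists (UNIV \<times> S)" using w by blast
  qed
  moreover have "countable (lists ((UNIV :: bool set) \<times> S))"
    using S(1) by (intro countable_lists countable_finite finite_cartesian_product) auto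
  ultimately show ?thesis by (meson countable_image countable_subset)
qed

text \<open>A homomorphism from a finitely generated group is determined by finitely many values.\<close>

lemma countable_isomorphic_quotients:
  fixes K :: "nat set \<Rightarrow> 'a set"
  assumes "group G" "fin_gen_group G" and K: "\<And>j. K j \<lhd> G" "inj K"
  shows "countable {j. G Mod K i \<cong> G Mod K j}"
proof -
  interpret G: group G by fact
  obtain S where S: "finite S" "S \<subseteq> carrier G" "generate G S = carrier G"
    using assms by (auto simp: fin_gen_group_def)
  obtain xs where xs: "set xs = S" using finite_list[OF S(1)] by blast
  let ?H = "G Mod K i" and ?J = "{j. G Mod K i \<cong> G Mod K j}"
  have H: "group ?H" using K(1) by (rule normal.factorgroup_is_group)
  \<comment> \<open>All isomorphisms are directed to the fixed group \<open>?H\<close>, so that the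
    maps for different \<open>j\<close> have a common countable target.\<close>
  have "\<exists>f. f \<in> iso (G Mod K j) ?H" if "j \<in> ?J" for j
  proof -
    have "G Mod K j \<cong> ?H" using that group.iso_sym[OF H] by simp
    then show ?thesis unfolding is_iso_def by blast
  qed
  then obtain \<phi> where \<phi>: "\<And>j. j \<in> ?J \<Longrightarrow> \<phi> j \<in> iso (G Mod K j) ?H" by metis
  define f where "f = (\<lambda>j x. \<phi> j (K j #>\<^bsub>G\<^esub> x))"
  have hom: "f j \<in> hom G ?H" if "j \<in> ?J" for j
    using hom_compose[OF normal.r_coset_hom_Mod[OF K(1)] iso_imp_homomorphism[OF \<phi>[OF that]]]
    by (simp add: f_def comp_def)
  have ker: "x \<in> K j \<longleftrightarrow> f j x = \<one>\<^bsub>?H\<^esub>" if j: "j \<in> ?J" and x: "x \<in> carrier G" for j x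
  proof -
    have gj: "group (G Mod K j)" using K(1) by (rule normal.factorgroup_is_group)
    have sub: "subgroup (K j) G" using K(1) by (rule normal_imp_subgroup)
    have "x \<in> K j \<longleftrightarrow> K j #>\<^bsub>G\<^esub> x = K j #>\<^bsub>G\<^esub> \<one>\<^bsub>G\<^esub>"
      using x by (simp add: G.rcos_eq_iff[OF sub])
    also have "\<dots> \<longleftrightarrow> K j #>\<^bsub>G\<^esub> x = \<one>\<^bsub>G Mod K j\<^esub>"
      using G.coset_mult_one[OF subgroup.subset[OF sub]] by simp
    also have "\<dots> \<longleftrightarrow> f j x = \<phi> j \<one>\<^bsub>G Mod K j\<^esub>"
    proof -
      have "inj_on (\<phi> j) (carrier (G Mod K j))" using \<phi>[OF j] by (simp add: iso_iff)
      moreover have "K j #>\<^bsub>G\<^esub> x \<in> carrier (G Mod K j)" using x by (simp add: carrier_FactGroup)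
      moreover have "\<one>\<^bsub>G Mod K j\<^esub> \<in> carrier (G Mod K j)" using group.is_monoid[OF gj] by (rule monoid.one_closed)
      ultimately show ?thesis unfolding f_def by (simp only: inj_on_eq_iff)
    qed
    also have "\<phi> j \<one>\<^bsub>G Mod K j\<^esub> = \<one>\<^bsub>?H\<^esub>"
      by (rule hom_one[OF iso_imp_homomorphism[OF \<phi>[OF j]] gj H])
    finally show ?thesis .
  qed
  \<comment> \<open>The values on the generators determine \<open>f j\<close>, which determines its
    kernel \<open>K j\<close> and thus \<open>j\<close>.\<close>
  have "inj_on (\<lambda>j. map (f j) xs) ?J"
  proof (rule inj_onI)
    fix j l assume j: "j \<in> ?J" and l: "l \<in> ?J" and eq: "map (f j) xs = map (f l) xs"
    have "f j x = f l x" if "x \<in> carrier G" for x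
      by (rule hom_eq_on_generate[OF assms(1) H hom[OF j] hom[OF l] S(2)]) (use that eq xs S(3) in auto)
    then have "x \<in> K j \<longleftrightarrow> x \<in> K l" if "x \<in> carrier G" for x using ker that j l by simp
    moreover have "K j \<subseteq> carrier G" "K l \<subseteq> carrier G"
      using K(1) by (meson normal_imp_subgroup subgroup.subset)+
    ultimately have "K j = K l" by blast
    then show "j = l" using K(2) by (simp add: inj_eq)
  qed
  moreover have "countable ((\<lambda>j. map (f j) xs) ` ?J)"
  proof (rule countable_subset)
    show "(\<lambda>j. map (f j) xs) ` ?J \<subseteq> lists (carrier ?H)"
    proof (rule image_subsetI)
      fix j assume "j \<in> ?J"
      then have "f j ` carrier G \<subseteq> carrier ?H" by (intro hom_carrier hom)
      then show "map (f j) xs \<in> lists (carrier ?H)" using S(2) xs by (auto simp: lists_eq_set)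
    qed
    show "countable (lists (carrier ?H))"
      using fin_gen_group_countable[OF assms(1,2)] by (simp add: carrier_FactGroup)
  qed
  ultimately show ?thesis by (rule countable_image_inj_on[rotated])
qed

text \<open>Isomorphism of the quotients is an equivalence relation on the indices with countable
  classes, so \<open>continuum_many_classes\<close> selects inequivalent ones.\<close>

lemma continuum_many_nonisomorphic_quotients:
  fixes K :: "nat set \<Rightarrow> 'a set"
  assumes "group G" "fin_gen_group G" and K: "\<And>j. K j \<lhd> G" "inj K"
  shows "\<exists>\<iota> :: nat set \<Rightarrow> nat set. \<forall>i j. i \<noteq> j \<longrightarrow> \<not> (G Mod K (\<iota> i) \<cong> G Mod K (\<iota> j))"
proof -
  let ?R = "{(i, j). G Mod K i \<cong> G Mod K j}"
  have sym: "G Mod K j \<cong> G Mod K i" if "G Mod K i \<cong> G Mod K j" for i j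
    using group.iso_sym[OF normal.factorgroup_is_group[OF K(1)] that] .
  have "equiv UNIV ?R"
    by (rule equivI) (auto simp: refl_on_def sym_def trans_def intro: sym iso_trans)
  from continuum_many_classes[OF this] show ?thesis
    using countable_isomorphic_quotients[OF assms] by (simp add: Image_singleton)
qed

section \<open>Torsion and residual finiteness of quotients\<close>

context group begin

lemma quotient_pow_eq_one:
  assumes "K \<lhd> G" "x \<in> carrier G"
  shows "(K #> x) [^]\<^bsub>G Mod K\<^esub> (n::nat) = \<one>\<^bsub>G Mod K\<^esub> \<longleftrightarrow> x [^] n \<in> K"
proof -
  interpret K: normal K G by fact
  show ?thesis using assms(2) rcos_eq_iff[OF K.subgroup_axioms, of "x [^] n" \<one>] coset_mult_one[OF K.subset]
    by (simp add: K.FactGroup_pow)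
qed

lemma quotient_p_subgroup:
  assumes K: "K \<lhd> G" and N: "N \<subseteq> carrier G" and p: "Factorial_Ring.prime p"
    and pow: "\<And>x. x \<in> N \<Longrightarrow> \<exists>k. x [^] (p ^ k :: nat) \<in> K"
  shows "p_subgroup_set p (G Mod K) ((\<lambda>x. K #> x) ` N)"
  unfolding p_subgroup_set_def
proof
  fix c assume "c \<in> (\<lambda>x. K #> x) ` N"
  then obtain x where x: "x \<in> N" "c = K #> x" by blast
  interpret Q: group "G Mod K" using K by (rule normal.factorgroup_is_group)
  have xG: "x \<in> carrier G" using x N by blast
  then have c: "c \<in> carrier (G Mod K)" by (simp add: carrier_FactGroup x(2))
  obtain k where "x [^] (p ^ k :: nat) \<in> K" using pow[OF x(1)] by blast
  then have "Q.ord c dvd p ^ k"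
    using quotient_pow_eq_one[OF K xG, of "p ^ k"] Q.pow_eq_id[OF c, of "p ^ k"] x(2) by simp
  then show "\<exists>k. Q.ord c = p ^ k" using divides_primepow_nat[OF p] by blast
qed

lemma finite_index_pow:
  assumes N: "N \<lhd> G" "finite (rcosets N)" and x: "x \<in> carrier G"
  shows "\<exists>m::nat. m > 0 \<and> x [^] m \<in> N"
proof -
  interpret Q: group "G Mod N" using N(1) by (rule normal.factorgroup_is_group)
  have fin: "finite (carrier (G Mod N))" using N(2) by (simp add: FactGroup_def)
  have "N #> x \<in> carrier (G Mod N)" using x by (simp add: carrier_FactGroup)
  from Q.pow_order_eq_1[OF this] have "x [^] order (G Mod N) \<in> N"
    using quotient_pow_eq_one[OF N(1) x] by simp
  moreover have "order (G Mod N) > 0" using Q.order_gt_0_iff_finite fin by simp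
  ultimately show ?thesis by blast
qed

text \<open>A positive power of each element lies in \<open>N\<close> by finite index, and a p-power
  of that lies in \<open>K\<close>.\<close>

lemma quotient_periodic:
  assumes K: "K \<lhd> G" and N: "N \<lhd> G" "finite (rcosets N)"
    and p: "p > 0" and pow: "\<And>x. x \<in> N \<Longrightarrow> \<exists>k. x [^] (p ^ k :: nat) \<in> K"
  shows "periodic_group (G Mod K)"
  unfolding periodic_group_def
proof
  fix c assume c: "c \<in> carrier (G Mod K)"
  then obtain x where x: "x \<in> carrier G" "c = K #> x" by (auto simp: carrier_FactGroup)
  interpret Q: group "G Mod K" using K by (rule normal.factorgroup_is_group)
  obtain m :: nat where m: "m > 0" "x [^] m \<in> N" using finite_index_pow[OF N x(1)] by blast
  obtain k where "(x [^] m) [^] (p ^ k :: nat) \<in> K" using pow[OF m(2)] by blast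
  then have "c [^]\<^bsub>G Mod K\<^esub> (m * p ^ k) = \<one>\<^bsub>G Mod K\<^esub>"
    using quotient_pow_eq_one[OF K x(1), of "m * p ^ k"] x by (simp add: nat_pow_pow)
  moreover have "m * p ^ k \<noteq> 0" using m(1) p by simp
  ultimately show "Q.ord c \<noteq> 0" using Q.ord_eq_0[OF c] by blast
qed

text \<open>An element outside \<open>K\<close> avoids some \<open>U\<close> of the family, and the
  image of this \<open>U\<close> in the quotient is normal of finite index and still avoids
  it.\<close>

lemma quotient_residually_finite:
  assumes K: "K \<lhd> G" "K = \<Inter>\<U>" and U: "\<And>U. U \<in> \<U> \<Longrightarrow> U \<lhd> G \<and> finite (rcosets U)"
  shows "residually_finite (G Mod K)"
  unfolding residually_finite_def
proof (intro ballI impI)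
  interpret K: normal K G by fact
  interpret Q: group "G Mod K" by (rule K.factorgroup_is_group)
  interpret \<pi>: group_hom G "G Mod K" "\<lambda>x. K #> x"
    using K.r_coset_hom_Mod by (simp add: group_hom_def group_hom_axioms_def group_axioms Q.group_axioms)
  note mult_FactGroup [simp del] and one_FactGroup [simp del]
  fix c assume c: "c \<in> carrier (G Mod K)" "c \<noteq> \<one>\<^bsub>G Mod K\<^esub>"
  obtain g where g: "g \<in> carrier G" "c = K #> g" using c(1) by (auto simp: carrier_FactGroup)
  have "g \<notin> K" using c(2) g quotient_pow_eq_one[OF K(1) g(1), of 1] by simp
  then obtain U where "U \<in> \<U>" and gU: "g \<notin> U" using K(2) by blast
  then have UG: "U \<lhd> G" "finite (rcosets U)" and KU: "K \<subseteq> U" using U K(2) by auto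
  interpret U: normal U G by (rule UG)
  let ?M = "(\<lambda>x. K #> x) ` U"
  have subM: "subgroup ?M (G Mod K)" by (rule \<pi>.subgroup_img_is_subgroup[OF U.subgroup_axioms])
  \<comment> \<open>As \<open>K\<close> lies in \<open>U\<close>, the full preimage of the image of
    \<open>U\<close> is \<open>U\<close> itself.\<close>
  have memM: "K #> x \<in> ?M \<longleftrightarrow> x \<in> U" if x: "x \<in> carrier G" for x
  proof
    assume "K #> x \<in> ?M"
    then obtain u where u: "u \<in> U" "K #> x = K #> u" by blast
    then have "x \<otimes> inv u \<in> U" using rcos_eq_iff[OF K.subgroup_axioms x] KU U.mem_carrier by blast
    then have "x \<otimes> inv u \<otimes> u \<in> U" using u by simp
    then show "x \<in> U" using x u(1) U.mem_carrier[OF u(1)] by (simp add: m_assoc)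
  qed simp
  have "?M \<lhd> (G Mod K)"
  proof (rule Q.normal_invI[OF subM])
    fix d m assume d: "d \<in> carrier (G Mod K)" and m: "m \<in> ?M"
    obtain y where y: "y \<in> carrier G" "d = K #> y" using d by (auto simp: carrier_FactGroup)
    obtain u where u: "u \<in> U" "m = K #> u" using m by blast
    have "d \<otimes>\<^bsub>G Mod K\<^esub> m \<otimes>\<^bsub>G Mod K\<^esub> inv\<^bsub>G Mod K\<^esub> d = K #> (y \<otimes> u \<otimes> inv y)"
      using y u U.mem_carrier[OF u(1)] by simp
    then show "d \<otimes>\<^bsub>G Mod K\<^esub> m \<otimes>\<^bsub>G Mod K\<^esub> inv\<^bsub>G Mod K\<^esub> d \<in> ?M"
      using U.inv_op_closed2[OF y(1) u(1)] by simp
  qed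
  moreover have "finite (rcosets\<^bsub>G Mod K\<^esub> ?M)"
  proof (rule Q.finite_rcosetsI[OF subM])
    \<comment> \<open>Lifting to \<open>G\<close> lets the finitely many cosets of \<open>U\<close>
      count those of \<open>?M\<close>.\<close>
    define s where "s = (\<lambda>d. SOME y. y \<in> carrier G \<and> d = K #> y)"
    have s: "s d \<in> carrier G \<and> d = K #> s d" if "d \<in> carrier (G Mod K)" for d
    proof -
      have "\<exists>y. y \<in> carrier G \<and> d = K #> y" using that by (auto simp: carrier_FactGroup)
      then show ?thesis unfolding s_def by (rule someI_ex)
    qed
    show "finite ((\<lambda>d. U #> s d) ` carrier (G Mod K))"
    proof (rule finite_subset[OF _ UG(2)])
      show "(\<lambda>d. U #> s d) ` carrier (G Mod K) \<subseteq> rcosets U"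
        using s U.subset by (intro image_subsetI rcosetsI) simp_all
    qed
    fix d e assume d: "d \<in> carrier (G Mod K)" and e: "e \<in> carrier (G Mod K)" and eq: "U #> s d = U #> s e"
    note sd = s[OF d] and se = s[OF e]
    have "s d \<otimes> inv (s e) \<in> U" using eq rcos_eq_iff[OF U.subgroup_axioms] sd se by blast
    then have "K #> (s d \<otimes> inv (s e)) \<in> ?M" by blast
    moreover have "K #> (s d \<otimes> inv (s e)) = (K #> s d) \<otimes>\<^bsub>G Mod K\<^esub> inv\<^bsub>G Mod K\<^esub> (K #> s e)"
      using sd se by simp
    ultimately show "d \<otimes>\<^bsub>G Mod K\<^esub> inv\<^bsub>G Mod K\<^esub> e \<in> ?M" using sd se by simp
  qed
  moreover have "c \<notin> ?M" using memM[OF g(1)] gU g(2) by simp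
  ultimately show "\<exists>M. M \<lhd> (G Mod K) \<and> finite (rcosets\<^bsub>G Mod K\<^esub> M) \<and> c \<notin> M" by blast
qed

end

section \<open>The tree of kernels\<close>

locale virtually_onto_free = G: group G + F: group F + N: normal N G
  for G :: "('a, 'b) monoid_scheme" and F :: "('c, 'd) monoid_scheme" and N :: "'a set" +
  fixes h :: "'a \<Rightarrow> 'c" and p :: nat
  assumes finite_index: "finite (rcosets\<^bsub>G\<^esub> N)"
    and h_hom: "h \<in> hom (G\<lparr>carrier := N\<rparr>) F" and h_onto: "h ` N = carrier F"
    and free: "free_group F" "nonabelian F"
    and p_prime: "Factorial_Ring.prime p"
begin

section \<open>Twists of the homomorphism and cores\<close>

definition twist :: "'a \<Rightarrow> 'a \<Rightarrow> 'c" where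
  "twist t x = h (t \<otimes>\<^bsub>G\<^esub> x \<otimes>\<^bsub>G\<^esub> inv\<^bsub>G\<^esub> t)"

text \<open>For normal \<open>V\<close> this is the normal core in \<open>G\<close> of the preimage
  of \<open>V\<close> under \<open>h\<close>. The preimage itself is normal in \<open>N\<close> but
  need not be normal in \<open>G\<close>.\<close>

definition core :: "'c set \<Rightarrow> 'a set" where
  "core V = {x \<in> N. \<forall>t\<in>carrier G. twist t x \<in> V}"

lemma h_group_hom: "group_hom (G\<lparr>carrier := N\<rparr>) F h"
  using h_hom N.subgroup_is_group[OF G.group_axioms]
  by (simp add: group_hom_def group_hom_axioms_def F.group_axioms)

lemma h_mult: "x \<in> N \<Longrightarrow> y \<in> N \<Longrightarrow> h (x \<otimes>\<^bsub>G\<^esub> y) = h x \<otimes>\<^bsub>F\<^esub> h y"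
  using group_hom.hom_mult[OF h_group_hom, of x y] by simp

lemma h_closed: "x \<in> N \<Longrightarrow> h x \<in> carrier F"
  using h_onto by blast

lemma h_one: "h \<one>\<^bsub>G\<^esub> = \<one>\<^bsub>F\<^esub>"
  using group_hom.hom_one[OF h_group_hom] by simp

lemma h_inv:
  assumes "x \<in> N"
  shows "h (inv\<^bsub>G\<^esub> x) = inv\<^bsub>F\<^esub> (h x)"
proof -
  have "h (inv\<^bsub>G\<^esub> x) \<otimes>\<^bsub>F\<^esub> h x = \<one>\<^bsub>F\<^esub>"
    using assms N.mem_carrier by (simp add: h_one flip: h_mult)
  then show ?thesis using assms by (intro F.inv_equality[symmetric]) (simp_all add: h_closed)
qed

lemma twist_mem: "x \<in> N \<Longrightarrow> t \<in> carrier G \<Longrightarrow> t \<otimes>\<^bsub>G\<^esub> x \<otimes>\<^bsub>G\<^esub> inv\<^bsub>G\<^esub> t \<in> N"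
  by (rule N.inv_op_closed2)

lemma twist_closed: "x \<in> N \<Longrightarrow> t \<in> carrier G \<Longrightarrow> twist t x \<in> carrier F"
  unfolding twist_def by (intro h_closed twist_mem)

lemma twist_mult:
  assumes "x \<in> N" "y \<in> N" "t \<in> carrier G"
  shows "twist t (x \<otimes>\<^bsub>G\<^esub> y) = twist t x \<otimes>\<^bsub>F\<^esub> twist t y"
proof -
  have "t \<otimes>\<^bsub>G\<^esub> (x \<otimes>\<^bsub>G\<^esub> y) \<otimes>\<^bsub>G\<^esub> inv\<^bsub>G\<^esub> t = (t \<otimes>\<^bsub>G\<^esub> x \<otimes>\<^bsub>G\<^esub> inv\<^bsub>G\<^esub> t) \<otimes>\<^bsub>G\<^esub> (t \<otimes>\<^bsub>G\<^esub> y \<otimes>\<^bsub>G\<^esub> inv\<^bsub>G\<^esub> t)"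
    using assms N.mem_carrier by (simp add: G.m_assoc G.mult_inv_cancel_left)
  then show ?thesis using h_mult[OF twist_mem[OF assms(1,3)] twist_mem[OF assms(2,3)]] by (simp add: twist_def)
qed

lemma twist_one: "t \<in> carrier G \<Longrightarrow> twist t \<one>\<^bsub>G\<^esub> = \<one>\<^bsub>F\<^esub>"
  by (simp add: twist_def h_one)

lemma twist_inv:
  assumes "x \<in> N" "t \<in> carrier G"
  shows "twist t (inv\<^bsub>G\<^esub> x) = inv\<^bsub>F\<^esub> (twist t x)"
proof -
  have "twist t (inv\<^bsub>G\<^esub> x) \<otimes>\<^bsub>F\<^esub> twist t x = \<one>\<^bsub>F\<^esub>"
    using assms N.mem_carrier by (simp add: twist_one flip: twist_mult)
  then show ?thesis using assms by (intro F.inv_equality[symmetric]) (simp_all add: twist_closed)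
qed

lemma pow_mem: "x \<in> N \<Longrightarrow> x [^]\<^bsub>G\<^esub> (n::nat) \<in> N"
  by (induction n) auto

lemma twist_pow:
  assumes "x \<in> N" "t \<in> carrier G"
  shows "twist t (x [^]\<^bsub>G\<^esub> (n::nat)) = twist t x [^]\<^bsub>F\<^esub> n"
  by (induction n) (use assms in \<open>simp_all add: twist_one twist_mult pow_mem\<close>)

text \<open>Conjugation by \<open>s\<close> only permutes the twists, which makes the core invariant
  under \<open>G\<close>.\<close>

lemma twist_twist:
  assumes "x \<in> N" "s \<in> carrier G" "t \<in> carrier G"
  shows "twist t (s \<otimes>\<^bsub>G\<^esub> x \<otimes>\<^bsub>G\<^esub> inv\<^bsub>G\<^esub> s) = twist (t \<otimes>\<^bsub>G\<^esub> s) x"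
  unfolding twist_def using assms N.mem_carrier by (simp add: G.m_assoc G.inv_mult_group)

definition rep :: "'a set \<Rightarrow> 'a" where
  "rep C = (SOME y. y \<in> carrier G \<and> N #>\<^bsub>G\<^esub> y = C)"

definition reps :: "'a set" where "reps = rep ` (rcosets\<^bsub>G\<^esub> N)"

lemma rep:
  assumes "x \<in> carrier G"
  shows "rep (N #>\<^bsub>G\<^esub> x) \<in> carrier G" "rep (N #>\<^bsub>G\<^esub> x) \<in> reps" "x \<otimes>\<^bsub>G\<^esub> inv\<^bsub>G\<^esub> (rep (N #>\<^bsub>G\<^esub> x)) \<in> N"
proof -
  have *: "rep (N #>\<^bsub>G\<^esub> x) \<in> carrier G \<and> N #>\<^bsub>G\<^esub> (rep (N #>\<^bsub>G\<^esub> x)) = N #>\<^bsub>G\<^esub> x"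
    unfolding rep_def by (rule someI[of _ x]) (simp add: assms)
  then show "rep (N #>\<^bsub>G\<^esub> x) \<in> carrier G" by blast
  show "rep (N #>\<^bsub>G\<^esub> x) \<in> reps" unfolding reps_def using G.rcosetsI[OF N.subset assms] by blast
  show "x \<otimes>\<^bsub>G\<^esub> inv\<^bsub>G\<^esub> (rep (N #>\<^bsub>G\<^esub> x)) \<in> N"
    using G.rcos_eq_iff[OF N.subgroup_axioms assms, of "rep (N #>\<^bsub>G\<^esub> x)"] * by simp
qed

lemma reps: "finite reps" "reps \<subseteq> carrier G"
  unfolding reps_def using finite_index rep(1) by (auto simp: RCOSETS_def)

text \<open>Twists by elements of the same coset of \<open>N\<close> are conjugate in \<open>F\<close>, so membership in the
  core is a condition on finitely many twists only.\<close>

lemma core_eq: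
  assumes "V \<lhd> F"
  shows "core V = {x \<in> N. \<forall>t\<in>reps. twist t x \<in> V}"
proof -
  have "twist t x \<in> V" if x: "x \<in> N" and V: "\<forall>t\<in>reps. twist t x \<in> V" and t: "t \<in> carrier G" for x t
  proof -
    define r where "r = rep (N #>\<^bsub>G\<^esub> t)"
    define n where "n = t \<otimes>\<^bsub>G\<^esub> inv\<^bsub>G\<^esub> r"
    have r: "r \<in> carrier G" "r \<in> reps" and n: "n \<in> N" using rep[OF t] by (simp_all add: r_def n_def)
    have y: "r \<otimes>\<^bsub>G\<^esub> x \<otimes>\<^bsub>G\<^esub> inv\<^bsub>G\<^esub> r \<in> N" using x r by (intro twist_mem)
    have "t \<otimes>\<^bsub>G\<^esub> x \<otimes>\<^bsub>G\<^esub> inv\<^bsub>G\<^esub> t = n \<otimes>\<^bsub>G\<^esub> (r \<otimes>\<^bsub>G\<^esub> x \<otimes>\<^bsub>G\<^esub> inv\<^bsub>G\<^esub> r) \<otimes>\<^bsub>G\<^esub> inv\<^bsub>G\<^esub> n"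
      using t r x N.mem_carrier by (simp add: n_def G.m_assoc G.inv_mult_group G.mult_inv_cancel_left)
    then have "twist t x = h n \<otimes>\<^bsub>F\<^esub> twist r x \<otimes>\<^bsub>F\<^esub> inv\<^bsub>F\<^esub> (h n)"
      using n y by (simp add: twist_def h_mult h_inv)
    then show ?thesis using F.normal_invE(2)[OF assms h_closed[OF n], of "twist r x"] V r by simp
  qed
  then show ?thesis using reps(2) unfolding core_def by blast
qed

lemma core_normal:
  assumes "V \<lhd> F"
  shows "core V \<lhd> G"
proof (rule G.normal_invI)
  interpret V: normal V F by fact
  show "subgroup (core V) G"
  proof (rule G.subgroupI)
    show "core V \<subseteq> carrier G" using N.subset by (auto simp: core_def)
    show "core V \<noteq> {}" using twist_one by (auto simp: core_def intro!: exI[of _ "\<one>\<^bsub>G\<^esub>"])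
  qed (auto simp: core_def twist_mult twist_inv)
  fix s x assume s: "s \<in> carrier G" and x: "x \<in> core V"
  have xN: "x \<in> N" using x by (simp add: core_def)
  then show "s \<otimes>\<^bsub>G\<^esub> x \<otimes>\<^bsub>G\<^esub> inv\<^bsub>G\<^esub> s \<in> core V"
    using x s twist_mem[OF xN s] by (simp add: core_def twist_twist)
qed

text \<open>A coset of \<open>core V\<close> is determined by the coset of \<open>N\<close> and, for
  the part \<open>m x\<close> in \<open>N\<close>, by the \<open>V\<close>-cosets of its finitely
  many twists by \<open>reps\<close>.\<close>

lemma core_finite_index:
  assumes "V \<lhd> F" "finite (rcosets\<^bsub>F\<^esub> V)"
  shows "finite (rcosets\<^bsub>G\<^esub> (core V))"
proof -
  interpret V: normal V F by fact
  define m where "m = (\<lambda>x. x \<otimes>\<^bsub>G\<^esub> inv\<^bsub>G\<^esub> (rep (N #>\<^bsub>G\<^esub> x)))"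
  have m: "m x \<in> N" if "x \<in> carrier G" for x using rep(3)[OF that] by (simp add: m_def)
  let ?f = "\<lambda>x. (N #>\<^bsub>G\<^esub> x, restrict (\<lambda>r. V #>\<^bsub>F\<^esub> twist r (m x)) reps)"
  have "?f ` carrier G \<subseteq> (rcosets\<^bsub>G\<^esub> N) \<times> PiE reps (\<lambda>_. rcosets\<^bsub>F\<^esub> V)"
    using m reps(2) N.subset V.subset
    by (intro image_subsetI) (auto intro!: G.rcosetsI F.rcosetsI twist_closed)
  moreover have "finite ((rcosets\<^bsub>G\<^esub> N) \<times> PiE reps (\<lambda>_. rcosets\<^bsub>F\<^esub> V))"
    using finite_index reps(1) assms(2) by (intro finite_cartesian_product finite_PiE) auto
  ultimately have fin: "finite (?f ` carrier G)" by (rule finite_subset)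
  show ?thesis
  proof (rule G.finite_rcosetsI[OF normal_imp_subgroup[OF core_normal[OF assms(1)]] fin])
    fix x y assume x: "x \<in> carrier G" and y: "y \<in> carrier G" and eq: "?f x = ?f y"
    have Nxy: "N #>\<^bsub>G\<^esub> x = N #>\<^bsub>G\<^esub> y" using eq by simp
    have "m x \<otimes>\<^bsub>G\<^esub> inv\<^bsub>G\<^esub> (m y) = x \<otimes>\<^bsub>G\<^esub> inv\<^bsub>G\<^esub> y"
      using x y rep(1)[OF y] by (simp add: m_def Nxy G.inv_mult_group G.m_assoc G.mult_inv_cancel_left)
    moreover have "m x \<otimes>\<^bsub>G\<^esub> inv\<^bsub>G\<^esub> (m y) \<in> core V"
      unfolding core_eq[OF assms(1)]
    proof (intro CollectI conjI ballI)
      show "m x \<otimes>\<^bsub>G\<^esub> inv\<^bsub>G\<^esub> (m y) \<in> N" using m x y by simp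
      fix r assume r: "r \<in> reps"
      then have rG: "r \<in> carrier G" using reps(2) by blast
      have "restrict (\<lambda>r. V #>\<^bsub>F\<^esub> twist r (m x)) reps r = restrict (\<lambda>r. V #>\<^bsub>F\<^esub> twist r (m y)) reps r"
        using eq by simp
      then have "V #>\<^bsub>F\<^esub> twist r (m x) = V #>\<^bsub>F\<^esub> twist r (m y)" using r by simp
      then have "twist r (m x) \<otimes>\<^bsub>F\<^esub> inv\<^bsub>F\<^esub> (twist r (m y)) \<in> V"
        using F.rcos_eq_iff[OF V.subgroup_axioms] twist_closed[OF m rG] x y by blast
      then show "twist r (m x \<otimes>\<^bsub>G\<^esub> inv\<^bsub>G\<^esub> (m y)) \<in> V"
        using m x y rG by (simp add: twist_mult twist_inv)
    qed
    ultimately show "x \<otimes>\<^bsub>G\<^esub> inv\<^bsub>G\<^esub> y \<in> core V" by simp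
  qed
qed

section \<open>Extension steps for states, that is, pairs of a relator set and a subgroup\<close>

definition extends :: "('c \<times> nat) set \<times> 'c set \<Rightarrow> ('c \<times> nat) set \<times> 'c set \<Rightarrow> bool" where
  "extends s s' \<longleftrightarrow> sparse_relators p F (fst s') (snd s') \<and> fst s \<subseteq> fst s' \<and> snd s' \<subseteq> snd s"

text \<open>The kernels of the finite p-quotients of \<open>F\<close> in which all relators die. The
  subgroups of \<open>G\<close> constructed below are intersections of their cores.\<close>

definition admissible :: "('c \<times> nat) set \<Rightarrow> 'c set set" where
  "admissible W = {U. p_index_normal p F U \<and> relators F W \<subseteq> U}"

lemma admissible_mono: "W \<subseteq> W' \<Longrightarrow> admissible W' \<subseteq> admissible W"
  by (auto simp: admissible_def relators_def)

lemma extends_trans: "extends s s' \<Longrightarrow> extends s' s'' \<Longrightarrow> extends s s''"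
  by (auto simp: extends_def)

text \<open>By \<open>core_eq\<close> only finitely many twists of \<open>g\<close> matter, and
  \<open>kill_powers\<close> handles them with a common exponent.\<close>

lemma extend_torsion:
  assumes "sparse_relators p F (fst s) (snd s)" and g: "g \<in> N"
  shows "\<exists>s' k. extends s s' \<and> (\<forall>U\<in>admissible (fst s'). g [^]\<^bsub>G\<^esub> (p ^ k :: nat) \<in> core U)"
proof -
  let ?A = "(\<lambda>t. twist t g) ` reps"
  have A: "finite ?A" "?A \<subseteq> carrier F" using reps twist_closed[OF g] by auto
  from F.kill_powers[OF p_prime A assms(1)] obtain W' V' k where
    W': "sparse_relators p F W' V'" "fst s \<subseteq> W'" "V' \<subseteq> snd s"
    and kill: "\<And>U w. p_index_normal p F U \<Longrightarrow> relators F W' \<subseteq> U \<Longrightarrow> w \<in> ?A \<Longrightarrow> w [^]\<^bsub>F\<^esub> (p ^ k :: nat) \<in> U"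
    by (elim exE conjE) blast
  have "g [^]\<^bsub>G\<^esub> (p ^ k :: nat) \<in> core U" if U: "U \<in> admissible W'" for U
  proof -
    have U': "p_index_normal p F U" "relators F W' \<subseteq> U" using U by (simp_all add: admissible_def)
    have "twist t (g [^]\<^bsub>G\<^esub> (p ^ k :: nat)) \<in> U" if t: "t \<in> reps" for t
      using kill[OF U', of "twist t g"] t reps(2) by (simp add: twist_pow[OF g] subset_iff)
    then show ?thesis using pow_mem[OF g] by (simp add: core_eq[OF F.p_index_normalD(1)[OF U'(1)]])
  qed
  moreover have "extends s (W', V')" using W' by (simp add: extends_def)
  ultimately show ?thesis by (intro exI[of _ "(W', V')"] exI[of _ k]) simp
qed

text \<open>All further relators added to \<open>s1\<close> lie in \<open>snd s1\<close>, so \<open>h x \<notin> snd s1\<close> keeps \<open>x\<close> alive for good.\<close>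

lemma extend_branch:
  assumes s: "sparse_relators p F (fst s) (snd s)"
  shows "\<exists>x\<in>N. \<exists>s0 s1. extends s s0 \<and> extends s s1 \<and> (\<forall>U\<in>admissible (fst s0). x \<in> core U) \<and> h x \<notin> snd s1"
proof -
  obtain S where S: "free_basis F S" using free(1) by (auto simp: free_group_def)
  obtain a b where ab: "a \<in> S" "b \<in> S" "a \<noteq> b" using F.nonabelian_basis[OF S free(2)] by blast
  from F.exponents_unbounded[OF S ab p_prime s] obtain y0 where y0: "y0 \<in> carrier F"
    "\<forall>k. \<exists>V'. p_index_normal p F V' \<and> relators F (fst s) \<subseteq> V' \<and> y0 [^]\<^bsub>F\<^esub> (p ^ k :: nat) \<notin> V'"
    by (elim bexE) (rule that)
  have "y0 \<in> h ` N" using y0(1) by (simp only: h_onto)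
  then obtain y where y: "y \<in> N" "h y = y0" by blast
  from extend_torsion[OF s y(1)] obtain s0 k where
    s0: "extends s s0" "\<forall>U\<in>admissible (fst s0). y [^]\<^bsub>G\<^esub> (p ^ k :: nat) \<in> core U"
    by (elim exE conjE) (rule that)
  \<comment> \<open>The exponent \<open>k\<close> is dictated by the branch that kills; since the
    exponents of \<open>y0\<close> are unbounded, the same power \<open>h x\<close> survives in some
    \<open>V'\<close> compatible with the relators of \<open>s\<close>.\<close>
  define x where "x = y [^]\<^bsub>G\<^esub> (p ^ k :: nat)"
  have "twist \<one>\<^bsub>G\<^esub> y = y0" using y N.mem_carrier by (simp add: twist_def)
  then have hx: "h x = y0 [^]\<^bsub>F\<^esub> (p ^ k :: nat)"
    using twist_pow[OF y(1) G.one_closed, of "p ^ k"] y(1) N.mem_carrier by (simp add: x_def twist_def)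
  obtain V' where V': "p_index_normal p F V'" "relators F (fst s) \<subseteq> V'" "h x \<notin> V'"
    using y0(2)[rule_format, of k] unfolding hx by blast
  have "sparse_relators p F (fst s) (V' \<inter> snd s)"
    using V' F.sparse_relatorsD[OF s]
    by (intro F.sparse_relators_shrink[OF s] F.p_index_normal_Int) auto
  \<comment> \<open>The surviving branch adds no relator; it only shrinks the subgroup, to one that
    misses \<open>h x\<close>.\<close>
  then have "extends s (fst s, V' \<inter> snd s)" by (simp add: extends_def)
  moreover have "h x \<notin> snd (fst s, V' \<inter> snd s)" using V'(3) by simp
  moreover have "\<forall>U\<in>admissible (fst s0). x \<in> core U" using s0(2) by (simp add: x_def)
  moreover have "x \<in> N" using y(1) by (simp add: x_def pow_mem)
  ultimately show ?thesis using s0(1)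
    by (intro bexI[of _ x] exI[of _ s0] exI[of _ "(fst s, V' \<inter> snd s)"] conjI)
qed

text \<open>Torsion of \<open>g\<close> is imposed on both branches after the split. The split
  persists, because the admissible families and the subgroups of the states only shrink.\<close>

lemma extend_branch_torsion:
  assumes s: "sparse_relators p F (fst s) (snd s)" and g: "g \<in> N"
  shows "\<exists>x s0 s1. extends s s0 \<and> extends s s1 \<and>
    (\<exists>k. \<forall>U\<in>admissible (fst s0). g [^]\<^bsub>G\<^esub> (p ^ k :: nat) \<in> core U) \<and>
    (\<exists>k. \<forall>U\<in>admissible (fst s1). g [^]\<^bsub>G\<^esub> (p ^ k :: nat) \<in> core U) \<and>
    x \<in> N \<and> (\<forall>U\<in>admissible (fst s0). x \<in> core U) \<and> h x \<notin> snd s1"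
proof -
  from extend_branch[OF s] obtain x s0 s1 where x: "x \<in> N" "extends s s0" "extends s s1"
    "\<forall>U\<in>admissible (fst s0). x \<in> core U" "h x \<notin> snd s1"
    by (elim bexE exE conjE) (rule that)
  have "sparse_relators p F (fst s0) (snd s0)" "sparse_relators p F (fst s1) (snd s1)"
    using x by (simp_all add: extends_def)
  from extend_torsion[OF this(1) g] extend_torsion[OF this(2) g] obtain s0' k s1' l where
    s0': "extends s0 s0'" "\<forall>U\<in>admissible (fst s0'). g [^]\<^bsub>G\<^esub> (p ^ k :: nat) \<in> core U" and
    s1': "extends s1 s1'" "\<forall>U\<in>admissible (fst s1'). g [^]\<^bsub>G\<^esub> (p ^ l :: nat) \<in> core U"
    by (elim exE conjE) (rule that)
  have "admissible (fst s0') \<subseteq> admissible (fst s0)" using s0'(1) by (intro admissible_mono) (simp add: extends_def)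
  then have "\<forall>U\<in>admissible (fst s0'). x \<in> core U" using x(4) by blast
  moreover have "h x \<notin> snd s1'" using x(5) s1'(1) by (auto simp: extends_def)
  ultimately show ?thesis using x(1) s0'(2) s1'(2) extends_trans[OF x(2) s0'(1)] extends_trans[OF x(3) s1'(1)]
    by (intro exI[of _ x] exI[of _ s0'] exI[of _ s1'] conjI) (assumption | rule exI)+
qed

text \<open>Walk down a binary tree of states, making the i-th element of \<open>N\<close> torsion
  at stage \<open>i\<close>. Two branches part at a common state, whose witness \<open>x\<close>
  lies in one kernel and not in the other.\<close>

lemma continuum_many_kernels:
  assumes count: "countable (carrier G)"
  shows "\<exists>K :: nat set \<Rightarrow> 'a set. inj K \<and> (\<forall>j. (\<forall>x\<in>N. \<exists>k. x [^]\<^bsub>G\<^esub> (p ^ k :: nat) \<in> K j) \<and>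
    (\<exists>\<U>. \<U> \<noteq> {} \<and> K j = \<Inter>\<U> \<and> (\<forall>U\<in>\<U>. U \<lhd> G \<and> finite (rcosets\<^bsub>G\<^esub> U))))"
proof -
  define g where "g = from_nat_into N"
  have "countable N" using count N.subset by (rule countable_subset[rotated])
  then have g: "range g = N"
    unfolding g_def by (intro range_from_nat_into) (use N.one_closed in blast)
  then have gN: "g i \<in> N" for i by blast
  define good where "good = (\<lambda>s. sparse_relators p F (fst s) (snd s))"
  define branch where "branch = (\<lambda>s i x s0 s1. extends s s0 \<and> extends s s1 \<and>
    (\<exists>k. \<forall>U\<in>admissible (fst s0). g i [^]\<^bsub>G\<^esub> (p ^ k :: nat) \<in> core U) \<and>
    (\<exists>k. \<forall>U\<in>admissible (fst s1). g i [^]\<^bsub>G\<^esub> (p ^ k :: nat) \<in> core U) \<and>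
    x \<in> N \<and> (\<forall>U\<in>admissible (fst s0). x \<in> core U) \<and> h x \<notin> snd s1)"
  have "\<exists>x s0 s1. branch s i x s0 s1" if "good s" for s i
    unfolding branch_def using that gN by (intro extend_branch_torsion) (simp_all add: good_def)
  then obtain wit S0 S1 where wit: "\<And>s i. good s \<Longrightarrow> branch s i (wit s i) (S0 s i) (S1 s i)" by metis
  \<comment> \<open>Membership of \<open>i\<close> in \<open>j\<close> selects the branch at stage
    \<open>i\<close>; the root has no relators and the whole group as subgroup.\<close>
  define st where "st = (\<lambda>j. rec_nat ({}, carrier F)
    (\<lambda>i s. if i \<in> j then S0 s i else S1 s i))"
  have st0: "st j 0 = ({}, carrier F)" for j by (simp add: st_def)
  have stS: "st j (Suc i) = (if i \<in> j then S0 (st j i) i else S1 (st j i) i)" for i j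
    by (simp add: st_def)
  have step: "extends (st j i) (st j (Suc i))" if "good (st j i)" for j i
    using wit[OF that, of i] by (simp add: stS branch_def)
  have good: "good (st j i)" for j i
  proof (induction i)
    case 0
    then show ?case
      by (simp add: good_def st0 sparse_relators_def F.p_index_normal_carrier)
  next
    case (Suc i)
    then show ?case using step[OF Suc] by (simp add: extends_def good_def)
  qed
  have mono: "fst (st j i) \<subseteq> fst (st j l)" "snd (st j l) \<subseteq> snd (st j i)" if "i \<le> l" for i j l
  proof -
    have "fst (st j n) \<subseteq> fst (st j (Suc n))" "snd (st j (Suc n)) \<subseteq> snd (st j n)" for n
      using step[OF good, of j n] by (simp_all add: extends_def)
    then show "fst (st j i) \<subseteq> fst (st j l)" "snd (st j l) \<subseteq> snd (st j i)"
      using lift_Suc_mono_le[of "\<lambda>n. fst (st j n)", OF _ that]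
        lift_Suc_antimono_le[of "\<lambda>n. snd (st j n)", OF _ that] by blast+
  qed
  define fam where "fam = (\<lambda>j. \<Inter>i. admissible (fst (st j i)))"
  define K where "K = (\<lambda>j. \<Inter>(core ` fam j))"
  \<comment> \<open>Keeps the family nonempty, so that the intersection \<open>K j\<close> stays
    inside \<open>G\<close>.\<close>
  have carrier_fam: "carrier F \<in> fam j" for j
  proof -
    have "relators F (fst (st j i)) \<subseteq> carrier F" for i
      using F.sparse_relatorsD[OF good[unfolded good_def, of j i]] F.p_index_normalD(2) subgroup.subset by blast
    then show ?thesis by (simp add: fam_def admissible_def F.p_index_normal_carrier)
  qed
  have torsion: "\<exists>k. x [^]\<^bsub>G\<^esub> (p ^ k :: nat) \<in> K j" if x: "x \<in> N" for x j
  proof -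
    obtain i where i: "x = g i" using x g by blast
    have "\<exists>k. \<forall>U\<in>admissible (fst (st j (Suc i))). g i [^]\<^bsub>G\<^esub> (p ^ k :: nat) \<in> core U"
      using wit[OF good, of j i i] by (simp add: stS branch_def)
    then obtain k where "\<forall>U\<in>admissible (fst (st j (Suc i))). x [^]\<^bsub>G\<^esub> (p ^ k :: nat) \<in> core U"
      using i by blast
    then show ?thesis by (intro exI[of _ k]) (auto simp: K_def fam_def)
  qed
  have finite_index: "\<forall>U\<in>core ` fam j. U \<lhd> G \<and> finite (rcosets\<^bsub>G\<^esub> U)" for j
    using core_normal core_finite_index F.p_index_normalD(1,3) by (auto simp: fam_def admissible_def)
  have nonempty: "core ` fam j \<noteq> {}" for j using carrier_fam by blast
  have "inj K"
  proof (rule injI)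
    have separate: "K i \<noteq> K j" if l: "l \<in> i" "l \<notin> j" "st i l = st j l" for i j l
    proof -
      let ?s = "st i l"
      define x s1 where "x = wit ?s l" and "s1 = S1 ?s l"
      have st: "st i (Suc l) = S0 ?s l" "st j (Suc l) = s1" using l by (simp_all add: stS s1_def)
      have x: "x \<in> N" "\<forall>U\<in>admissible (fst (S0 ?s l)). x \<in> core U" "h x \<notin> snd s1"
        using wit[OF good, of i l l] by (simp_all add: x_def s1_def branch_def)
      have "fam i \<subseteq> admissible (fst (st i (Suc l)))" unfolding fam_def by (rule INT_lower) simp
      then have "x \<in> K i" using x(2) by (auto simp: K_def st(1))
      moreover have "snd s1 \<in> fam j"
      proof -
        \<comment> \<open>A relator of stage \<open>n\<close> is still present at stage
          \<open>max n (Suc l)\<close>, whose subgroup contains it and lies in that of stage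
          \<open>Suc l\<close>.\<close>
        have "relators F (fst (st j n)) \<subseteq> snd s1" for n
        proof -
          have "relators F (fst (st j n)) \<subseteq> relators F (fst (st j (max n (Suc l))))"
            unfolding relators_def by (intro image_mono mono) simp
          also have "\<dots> \<subseteq> snd (st j (max n (Suc l)))"
            using F.sparse_relatorsD(2)[OF good[unfolded good_def]] .
          also have "\<dots> \<subseteq> snd (st j (Suc l))" by (intro mono) simp
          finally show ?thesis by (simp add: st)
        qed
        moreover have "p_index_normal p F (snd s1)"
          using F.sparse_relatorsD(1)[OF good[unfolded good_def, of j "Suc l"]] by (simp add: st)
        ultimately show ?thesis by (simp add: fam_def admissible_def)
      qed
      moreover have "x \<notin> core (snd s1)"
        using x N.mem_carrier by (auto simp: core_def twist_def intro!: bexI[of _ "\<one>\<^bsub>G\<^esub>"])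
      ultimately show ?thesis by (auto simp: K_def)
    qed
    fix i j assume eq: "K i = K j"
    show "i = j"
    proof (rule ccontr)
      assume "i \<noteq> j"
      then have ex: "\<exists>l. (l \<in> i) \<noteq> (l \<in> j)" by blast
      \<comment> \<open>At the least difference the two branches still share their state, as
        \<open>separate\<close> requires.\<close>
      define l where "l = (LEAST l. (l \<in> i) \<noteq> (l \<in> j))"
      have l: "(l \<in> i) \<noteq> (l \<in> j)" unfolding l_def using ex by (rule LeastI_ex)
      have less: "(n \<in> i) = (n \<in> j)" if "n < l" for n using not_less_Least that unfolding l_def by blast
      have "st i n = st j n" if "n \<le> l" for n
        using that by (induction n) (simp_all add: st0 stS less)
      then show False using separate[of l i j] separate[of l j i] l eq by auto
    qed
  qed
  then show ?thesis
    by (intro exI[of _ K] conjI allI ballI torsion exI[of _ "core ` fam _"] nonempty finite_index)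
      (simp_all add: K_def)
qed

end

theorem theorem1p5:
  fixes G :: "('a, 'b) monoid_scheme" and N :: "'a set"
    and F :: "('c, 'd) monoid_scheme" and h :: "'a \<Rightarrow> 'c" and p :: nat
  assumes "group G"
    and "fin_gen_group G"
    and "N \<lhd> G"
    and "finite (rcosets\<^bsub>G\<^esub> N)"
    and "free_group F" and "nonabelian F"
    and "h \<in> hom (G\<lparr>carrier := N\<rparr>) F" and "h ` N = carrier F"
    and "Factorial_Ring.prime p"
  shows "\<exists>K :: nat set \<Rightarrow> 'a set.
           (\<forall>j. K j \<lhd> G
                \<and> periodic_group (G Mod K j)
                \<and> residually_finite (G Mod K j)
                \<and> p_subgroup_set p (G Mod K j) ((\<lambda>x. K j #>\<^bsub>G\<^esub> x) ` N))
         \<and> (\<forall>i j. i \<noteq> j \<longrightarrow> \<not> (G Mod K i \<cong> G Mod K j))"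
proof -
  interpret G: group G by fact
  interpret virtually_onto_free G F N h p
    using assms by (simp add: virtually_onto_free_def virtually_onto_free_axioms_def free_group_def)
  obtain K :: "nat set \<Rightarrow> 'a set" where K: "inj K"
    "\<And>j x. x \<in> N \<Longrightarrow> \<exists>k. x [^]\<^bsub>G\<^esub> (p ^ k :: nat) \<in> K j"
    "\<And>j. \<exists>\<U>. \<U> \<noteq> {} \<and> K j = \<Inter>\<U> \<and> (\<forall>U\<in>\<U>. U \<lhd> G \<and> finite (rcosets\<^bsub>G\<^esub> U))"
    using continuum_many_kernels[OF fin_gen_group_countable[OF assms(1,2)]]
    by (elim exE conjE) (rule that, blast+)
  have quot: "K j \<lhd> G \<and> residually_finite (G Mod K j)" for j
  proof -
    from K(3)[of j] obtain \<U> where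
      \<U>: "\<U> \<noteq> {}" "K j = \<Inter>\<U>" "\<forall>U\<in>\<U>. U \<lhd> G \<and> finite (rcosets\<^bsub>G\<^esub> U)"
      by (elim exE conjE) (rule that)
    have normal: "K j \<lhd> G"
    proof (rule G.normal_invI)
      show "subgroup (K j) G"
        unfolding \<U>(2) by (rule G.subgroups_Inter) (use \<U>(1,3) normal_imp_subgroup in auto)
      fix x y assume x: "x \<in> carrier G" and y: "y \<in> K j"
      have "x \<otimes>\<^bsub>G\<^esub> y \<otimes>\<^bsub>G\<^esub> inv\<^bsub>G\<^esub> x \<in> U" if "U \<in> \<U>" for U
        by (rule G.normal_invE(2)[OF _ x]) (use that \<U>(2,3) y in auto)
      then show "x \<otimes>\<^bsub>G\<^esub> y \<otimes>\<^bsub>G\<^esub> inv\<^bsub>G\<^esub> x \<in> K j" unfolding \<U>(2) by (rule InterI)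
    qed
    have "residually_finite (G Mod K j)"
      by (rule G.quotient_residually_finite[OF normal \<U>(2)]) (use \<U>(3) in blast)
    with normal show ?thesis by (rule conjI)
  qed
  \<comment> \<open>Distinct kernels may still have isomorphic quotients; reindexing along
    \<open>\<iota>\<close> keeps at most one per isomorphism type.\<close>
  obtain \<iota> :: "nat set \<Rightarrow> nat set" where \<iota>: "\<forall>i j. i \<noteq> j \<longrightarrow> \<not> (G Mod K (\<iota> i) \<cong> G Mod K (\<iota> j))"
    using continuum_many_nonisomorphic_quotients[OF assms(1,2) conjunct1[OF quot] K(1)] by (elim exE) (rule that)
  show ?thesis
  proof (intro exI[of _ "\<lambda>j. K (\<iota> j)"] conjI allI impI)
    fix j
    show "K (\<iota> j) \<lhd> G" "residually_finite (G Mod K (\<iota> j))" by (simp_all add: quot)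
    show "periodic_group (G Mod K (\<iota> j))"
      by (rule G.quotient_periodic[OF _ assms(3,4) _ K(2)]) (simp_all add: quot prime_gt_0_nat p_prime)
    show "p_subgroup_set p (G Mod K (\<iota> j)) ((\<lambda>x. K (\<iota> j) #>\<^bsub>G\<^esub> x) ` N)"
      by (rule G.quotient_p_subgroup[OF _ N.subset p_prime K(2)]) (simp add: quot)
  qed (rule \<iota>[rule_format])
qed

end
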